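(* Let $n\ge 2$, let $u=s_{1,i_1}\cdots s_{n-1,i_{n-1}}\in S_n$ (in normal form), and let $t\in[1,n-1]$. Then: (i) $\partial_u\mathfrak{S}_{w_0^n}$ is monic and $\overline{\partial_u\mathfrak{S}_{w_0^n}}=X^u_{n-1}\cdots X^u_1$, where $X^u_j=X[1,i_j-m^u_j-1]\prod_{1\le k\le m^u_j}x_{1+q^u_{j,k}}$ for every $j\in[1,n-1]$. Moreover, the map $\varphi:S_n\to B_x$, $\varphi(u)=X^u_{n-1}\cdots X^u_1$, is a bijection. In particular, for any $v\in S_n$, if $u\ne v$ then $\overline{\partial_u\mathfrak{S}_{w_0^n}}\ne\overline{\partial_v\mathfrak{S}_{w_0^n}}$. (ii) The word $s_tu$ is reduced if and only if $\deg_{x_t}(\overline{\partial_u\mathfrak{S}_{w_0^n}})>\deg_{x_{t+1}}(\overline{\partial_u\mathfrak{S}_{w_0^n}})$. Moreover, if $\deg_{x_t}(\overline{\partial_u\mathfrak{S}_{w_0^n}})>\deg_{x_{t+1}}(\overline{\partial_u\mathfrak{S}_{w_0^n}})$, or equivalently $s_tu$ is reduced, then $\overline{\partial_{s_tu}\mathfrak{S}_{w_0^n}}=\overline{\partial_{s_t}\bigl(\overline{\partial_u\mathfrak{S}_{w_0^n}}\bigr)}$.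
   Context: $\mathbb{N}$ is the set of nonnegative integers. For integers $i,j$: $[i,j]=\{i,\ldots,j\}$ if $i\le j$ and $\emptyset$ otherwise; $X[i,j]=x_ix_{i+1}\cdots x_j$ if $i\le j$ and $1$ otherwise. $S_n$ is generated by $s_1,\ldots,s_{n-1}$, $s_i=(i,i+1)$. For $j\le i$, $s_{i,j}$ is the word $s_is_{i-1}\cdots s_j$; $s_{i,j}=1$ (empty word) if $j>i$. Every element of $S_n$ is represented by exactly one word $s_{1,i_1}s_{2,i_2}\cdots s_{n-1,i_{n-1}}$ with $1\le i_j\le j+1$, called its normal form; elements of $S_n$ are always written in normal form. A word is reduced if no shorter word represents the same element. $s_if$ is the result of interchanging $x_i,x_{i+1}$ in the polynomial $f$, $\partial_i(f)=\frac{f-s_if}{x_i-x_{i+1}}$; for a word $w=s_{a_1}\cdots s_{a_p}$, $\partial_w=\partial_{a_1}\cdots\partial_{a_p}$ (identity for the empty word). $\mathfrak{S}_{w_0^n}=x_1^{n-1}x_2^{n-2}\cdots x_{n-2}^2x_{n-1}$. $B_x=\{x_1^{k_1}\cdots x_{n-1}^{k_{n-1}}\mid k_i\in\mathbb{N},\ k_i+i\le n,\ 1\le i\le n-1\}$. For a monomial $W=x_1^{k_1}\cdots x_{n-1}^{k_{n-1}}$, $\deg_{x_t}(W)=k_t$ (and $\deg_{x_n}(W)=0$). Monomial order: for $U=x_1^{k_1}\cdots x_{n-1}^{k_{n-1}}$ and $V=x_1^{l_1}\cdots x_{n-1}^{l_{n-1}}$, $U<V$ iff $(\sum_ik_i,k_{n-1},\ldots,k_2,k_1)<(\sum_il_i,l_{n-1},\ldots,l_2,l_1)$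 lexicographically. For a nonzero polynomial $f$, $\bar f$ is the leading (i.e. largest) monomial of $f$ in this order, without coefficient; $f$ is monic if the coefficient of $\bar f$ in $f$ is $1$. For $u=s_{1,i_1}\cdots s_{n-1,i_{n-1}}\in S_n$ and $1\le r\le n-1$, put $q^u_{r,0}=r$ and $M^u_{r,1}=\{j\in\mathbb{N}\mid 1\le j<q^u_{r,0},\ i_r-1\in[i_j,j]\}$. Inductively, if $M^u_{r,l}\ne\emptyset$ put $q^u_{r,l}=\max M^u_{r,l}$ and $M^u_{r,l+1}=\{j\in\mathbb{N}\mid 1\le j<q^u_{r,l},\ i_r-(l+1)\in[i_j,j]\}$; if $M^u_{r,l}=\emptyset$ put $m^u_r=l-1$ and stop. *)

theory Defs
  imports
    "HOL-Library.Poly_Mapping"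
    "HOL-Library.FuncSet"
    "HOL-Combinatorics.Permutations"
begin

(* Monomials are exponent vectors, written additively; the variable x_k is indexed by k >= 1.
   Polynomials are integer combinations of such monomials, with product given by convolution. *)

type_synonym monom = "nat \<Rightarrow>\<^sub>0 nat"
type_synonym zpoly = "monom \<Rightarrow>\<^sub>0 int"

definition mpoly_of_monom :: "monom \<Rightarrow> zpoly"
  where "mpoly_of_monom W = Poly_Mapping.single W 1"

definition var_monom :: "nat \<Rightarrow> monom"
  where "var_monom k = Poly_Mapping.single k 1"

definition var :: "nat \<Rightarrow> zpoly"
  where "var k = mpoly_of_monom (var_monom k)"

(* A word s_{a_1} ... s_{a_p} is the list [a_1, ..., a_p]; it acts with its last letter first,
   in accordance with the order of the operators in divdiff_word. *)

definition word_perm :: "nat list \<Rightarrow> nat \<Rightarrow> nat"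
  where "word_perm w = foldr (\<lambda>a p. transpose a (Suc a) \<circ> p) w id"

(* Reducedness of a word in the generators s_1, ..., s_{n-1} of S_n. *)
definition reduced_word :: "nat \<Rightarrow> nat list \<Rightarrow> bool"
  where "reduced_word n w \<longleftrightarrow>
    (\<forall>w'. set w' \<subseteq> {1..n - 1} \<and> word_perm w' = word_perm w \<longrightarrow> length w \<le> length w')"

(* s_{i,j} = s_i s_{i-1} ... s_j, which is empty if j > i *)
definition desc_word :: "nat \<Rightarrow> nat \<Rightarrow> nat list"
  where "desc_word i j = rev [j..<Suc i]"

definition word_of_index :: "nat \<Rightarrow> (nat \<Rightarrow> nat) \<Rightarrow> nat list"
  where "word_of_index n i = concat (map (\<lambda>j. desc_word j (i j)) [1..<n])"

(* The index sequences (i_1, ..., i_{n-1}) are extensional functions, so that they are unique. *)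
definition index_seqs :: "nat \<Rightarrow> (nat \<Rightarrow> nat) set"
  where "index_seqs n = (\<Pi>\<^sub>E j\<in>{1..n - 1}. {1..j + 1})"

(* For a permutation u of {1..n} such a sequence exists and is unique: see nf_index_ex1. *)
definition nf_index :: "nat \<Rightarrow> (nat \<Rightarrow> nat) \<Rightarrow> nat \<Rightarrow> nat"
  where "nf_index n u = (THE i. i \<in> index_seqs n \<and> word_perm (word_of_index n i) = u)"

definition nf_word :: "nat \<Rightarrow> (nat \<Rightarrow> nat) \<Rightarrow> nat list"
  where "nf_word n u = word_of_index n (nf_index n u)"

lemma word_perm_Nil [simp]: "word_perm [] = id"
  and word_perm_Cons [simp]: "word_perm (a # w) = transpose a (Suc a) \<circ> word_perm w"
  by (simp_all add: word_perm_def)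

lemma word_perm_append: "word_perm (v @ w) = word_perm v \<circ> word_perm w"
  by (induction v) (simp_all add: comp_assoc)

lemma word_perm_permutes: "set w \<subseteq> {1..n - 1} \<Longrightarrow> word_perm w permutes {1..n}"
proof (induction w)
  case Nil
  show ?case by (simp only: word_perm_Nil permutes_id)
next
  case (Cons a w)
  then have "transpose a (Suc a) permutes {1..n}"
    by (intro permutes_swap_id) auto
  moreover have "word_perm w permutes {1..n}" using Cons by simp
  ultimately show ?case unfolding word_perm_Cons by (intro permutes_compose)
qed

lemma set_word_of_index:
  assumes "i \<in> index_seqs n"
  shows "set (word_of_index n i) \<subseteq> {1..n - 1}"
proof
  fix a assume "a \<in> set (word_of_index n i)"
  then obtain j where j: "1 \<le> j" "j < n" "i j \<le> a" "a \<le> j"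
    by (auto simp: word_of_index_def desc_word_def simp del: upt_Suc split: if_splits)
  then have "1 \<le> i j"
    using assms by (auto simp: index_seqs_def PiE_iff)
  with j show "a \<in> {1..n - 1}" by simp
qed

lemma word_of_index_Suc:
  "n \<ge> 1 \<Longrightarrow> word_of_index (Suc n) i = word_of_index n i @ desc_word n (i n)"
  by (simp add: word_of_index_def)

lemma word_of_index_cong:
  "(\<And>j. j \<in> {1..n - 1} \<Longrightarrow> i j = i' j) \<Longrightarrow> word_of_index n i = word_of_index n i'"
  unfolding word_of_index_def by (intro arg_cong[where f = concat] map_cong) auto

lemma desc_word_last: "j \<le> Suc i \<Longrightarrow> word_perm (desc_word i j) j = Suc i"
proof (induction i)
  case 0
  then show ?case by (cases "j = 0") (auto simp: desc_word_def)
next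
  case (Suc i)
  show ?case
  proof (cases "j = Suc (Suc i)")
    case True
    then show ?thesis by (simp add: desc_word_def)
  next
    case False
    with Suc.prems have "desc_word (Suc i) j = Suc i # desc_word i j"
      by (simp add: desc_word_def)
    with Suc False show ?thesis by simp
  qed
qed

lemma nf_index_ex1:
  assumes "n \<ge> 1" "u permutes {1..n}"
  shows "\<exists>!i. i \<in> index_seqs n \<and> word_perm (word_of_index n i) = u"
  using assms
proof (induction n arbitrary: u rule: nat_induct_at_least)
  case base
  then have "u = id" by simp
  then show ?case
    by (intro ex1I[of _ "\<lambda>_. undefined"]) (auto simp: index_seqs_def word_of_index_def)
next
  case (Suc n u)
  define k where "k = inv u (Suc n)"
  define d where "d = word_perm (desc_word n k)"
  have uk: "u k = Suc n"
    using Suc.prems by (simp add: k_def permutes_inverses)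
  have k: "k \<in> {1..Suc n}"
    using permutes_in_image[OF permutes_inv[OF Suc.prems], of "Suc n"] by (simp add: k_def)
  have d: "d permutes {1..Suc n}"
    unfolding d_def by (rule word_perm_permutes) (use k in \<open>auto simp: desc_word_def\<close>)
  have dk: "d k = Suc n"
    unfolding d_def by (rule desc_word_last) (use k in auto)
  define p where "p = u \<circ> inv d"
  have pd: "p \<circ> d = u"
    using d by (simp add: p_def comp_assoc permutes_inv_o)
  have "p permutes {1..Suc n}"
    unfolding p_def using d Suc.prems by (intro permutes_compose permutes_inv)
  moreover have "p (Suc n) = Suc n"
    using pd dk uk by (metis comp_apply)
  ultimately have p: "p permutes {1..n}"
    by (elim permutes_superset) (auto simp: le_Suc_eq)
  obtain i where i: "i \<in> index_seqs n" "word_perm (word_of_index n i) = p"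
    and uniq: "\<And>i'. i' \<in> index_seqs n \<Longrightarrow> word_perm (word_of_index n i') = p \<Longrightarrow> i' = i"
    using Suc.IH[OF p] by (elim ex1E) blast
  show ?case
  proof (rule ex1I[of _ "i(n := k)"])
    have "word_of_index n (i(n := k)) = word_of_index n i"
      by (rule word_of_index_cong) (use Suc.hyps in auto)
    then have "word_perm (word_of_index (Suc n) (i(n := k))) = u"
      using i pd Suc.hyps by (simp add: word_of_index_Suc word_perm_append d_def)
    moreover have "i(n := k) \<in> index_seqs (Suc n)"
      using i k Suc.hyps by (fastforce simp: index_seqs_def PiE_iff extensional_def)
    ultimately show "i(n := k) \<in> index_seqs (Suc n) \<and>
        word_perm (word_of_index (Suc n) (i(n := k))) = u" by simp
  next
    fix i' assume i': "i' \<in> index_seqs (Suc n) \<and> word_perm (word_of_index (Suc n) i') = u"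
    define i0 where "i0 = restrict i' {1..n - 1}"
    have i0: "i0 \<in> index_seqs n"
      using i' by (fastforce simp: i0_def index_seqs_def PiE_iff)
    have i'n: "1 \<le> i' n" "i' n \<le> Suc n"
      using i' Suc.hyps by (auto simp: index_seqs_def PiE_iff)
    have "word_of_index n i' = word_of_index n i0"
      by (rule word_of_index_cong) (simp add: i0_def)
    then have u: "u = word_perm (word_of_index n i0) \<circ> word_perm (desc_word n (i' n))"
      using i' Suc.hyps by (simp add: word_of_index_Suc word_perm_append)
    have p0: "word_perm (word_of_index n i0) permutes {1..n}"
      by (intro word_perm_permutes set_word_of_index i0)
    have "u (i' n) = Suc n"
      using u i'n desc_word_last[of "i' n" n] permutes_not_in[OF p0, of "Suc n"] by simp
    then have ink: "i' n = k"
      using Suc.prems by (metis k_def permutes_inverses(2))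
    have "word_perm (word_of_index n i0) = p"
      using u pd surj_fun_eq[of d UNIV] permutes_surj[OF d] by (metis d_def ink)
    then have "i0 = i" using uniq i0 by blast
    show "i' = i(n := k)"
    proof
      fix j show "i' j = (i(n := k)) j"
      proof (cases "j \<in> {1..n - 1}")
        case True
        then show ?thesis using \<open>i0 = i\<close> Suc.hyps by (auto simp: i0_def)
      next
        case False
        then show ?thesis
          using ink i i' Suc.hyps by (auto simp: index_seqs_def PiE_iff extensional_def)
      qed
    qed
  qed
qed

lemma nf_index:
  assumes "n \<ge> 1" "u permutes {1..n}"
  shows "nf_index n u \<in> index_seqs n" "word_perm (nf_word n u) = u"
  using theI'[OF nf_index_ex1[OF assms]] by (simp_all add: nf_index_def nf_word_def)

definition swap_vars :: "nat \<Rightarrow> zpoly \<Rightarrow> zpoly"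
  where "swap_vars i f =
    Poly_Mapping.map_key (Poly_Mapping.map_key (transpose i (Suc i)) :: monom \<Rightarrow> monom) f"

(* The exact quotient (f - s_i f) / (x_i - x_{i+1}): see divdiff_ex1. *)
definition divdiff :: "nat \<Rightarrow> zpoly \<Rightarrow> zpoly"
  where "divdiff i f = (THE g. (var i - var (Suc i)) * g = f - swap_vars i f)"

definition divdiff_word :: "nat list \<Rightarrow> zpoly \<Rightarrow> zpoly"
  where "divdiff_word w = foldr (\<lambda>a d. divdiff a \<circ> d) w id"

definition divdiff_perm :: "nat \<Rightarrow> (nat \<Rightarrow> nat) \<Rightarrow> zpoly \<Rightarrow> zpoly"
  where "divdiff_perm n u = divdiff_word (nf_word n u)"

definition schubert_top :: "nat \<Rightarrow> zpoly"
  where "schubert_top n = (\<Prod>k = 1..n - 1. var k ^ (n - k))"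

lemma inj_swap_exponents:
  "inj (Poly_Mapping.map_key (transpose i (Suc i)) :: monom \<Rightarrow> monom)"
  by (rule inj_on_inverseI[of _ "Poly_Mapping.map_key (transpose i (Suc i))"])
    (simp add: map_key_compose map_key_id[unfolded id_def[symmetric]] id_def[symmetric])

lemma lookup_swap_vars:
  "Poly_Mapping.lookup (swap_vars i f) W =
    Poly_Mapping.lookup f (Poly_Mapping.map_key (transpose i (Suc i)) W)"
  by (simp add: swap_vars_def map_key.rep_eq[OF inj_swap_exponents])

lemma swap_vars_single:
  "swap_vars i (Poly_Mapping.single W c) =
    Poly_Mapping.single (Poly_Mapping.map_key (transpose i (Suc i)) W) c"
proof -
  let ?s = "Poly_Mapping.map_key (transpose i (Suc i)) :: monom \<Rightarrow> monom"
  have "?s (?s W) = W"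
    by (simp add: map_key_compose map_key_id[unfolded id_def[symmetric]] id_def[symmetric])
  then show ?thesis
    unfolding swap_vars_def using map_key_single[OF inj_swap_exponents, of i "?s W" c] by simp
qed

lemma swap_vars_add: "swap_vars i (f + g) = swap_vars i f + swap_vars i g"
  by (simp add: swap_vars_def map_key_plus inj_swap_exponents)

lemma var_power: "var k ^ a = Poly_Mapping.single (Poly_Mapping.single k a) 1"
proof (induction a)
  case 0
  show ?case by simp
next
  case (Suc a)
  then show ?case
    by (simp add: var_def mpoly_of_monom_def var_monom_def mult_single single_add[symmetric])
qed

lemma dvd_swap_monom:
  "var i - var (Suc i) dvd Poly_Mapping.single W c - swap_vars i (Poly_Mapping.single W c)"
proof -
  define a b where "a = Poly_Mapping.lookup W i" and "b = Poly_Mapping.lookup W (Suc i)"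
  define R where "R = W - Poly_Mapping.single i a - Poly_Mapping.single (Suc i) b"
  have W: "W = R + Poly_Mapping.single i a + Poly_Mapping.single (Suc i) b"
    by (rule poly_mapping_eqI)
      (auto simp: R_def a_def b_def lookup_add lookup_minus lookup_single when_def)
  have W': "Poly_Mapping.map_key (transpose i (Suc i)) W =
      R + Poly_Mapping.single i b + Poly_Mapping.single (Suc i) a"
    by (rule poly_mapping_eqI)
      (auto simp: R_def a_def b_def lookup_add lookup_minus lookup_single when_def
        map_key.rep_eq transpose_def)
  let ?r = "Poly_Mapping.single R c :: zpoly"
  have e1: "Poly_Mapping.single W c = ?r * (var i ^ a * var (Suc i) ^ b)"
    by (subst W) (simp add: var_power mult_single add.assoc)
  have e2: "swap_vars i (Poly_Mapping.single W c) = ?r * (var i ^ b * var (Suc i) ^ a)"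
    by (simp add: swap_vars_single W' var_power mult_single add.assoc)
  have dvd: "x - y dvd x ^ m - y ^ m" for x y :: zpoly and m
    by (cases m) (simp_all add: diff_power_eq_sum del: power_Suc)
  have "var i ^ a * var (Suc i) ^ b - var i ^ b * var (Suc i) ^ a =
      (var i ^ a - var (Suc i) ^ a) * var (Suc i) ^ b -
      (var i ^ b - var (Suc i) ^ b) * var (Suc i) ^ a"
    by (simp add: algebra_simps)
  then have "var i - var (Suc i) dvd var i ^ a * var (Suc i) ^ b - var i ^ b * var (Suc i) ^ a"
    using dvd by (metis dvd_diff dvd_mult2)
  then show ?thesis
    unfolding e2 by (simp add: e1 right_diff_distrib[symmetric])
qed

lemma divdiff_ex1: "\<exists>!g. (var i - var (Suc i)) * g = f - swap_vars i f"
proof -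
  have "var i - var (Suc i) dvd f - swap_vars i f"
  proof (induction f rule: update_induct)
    case const
    show ?case by (simp add: swap_vars_def inj_swap_exponents)
  next
    case (update f W c)
    have "Poly_Mapping.update W c f = f + Poly_Mapping.single W c"
      using update(1) by (intro poly_mapping_eqI)
        (auto simp: lookup_update lookup_add lookup_single when_def in_keys_iff)
    then show ?case
      using dvd_add[OF update(3) dvd_swap_monom[of i W c]]
      by (simp add: swap_vars_add algebra_simps)
  qed
  moreover have "var i - var (Suc i) \<noteq> 0"
  proof
    assume "var i - var (Suc i) = 0"
    then have "Poly_Mapping.lookup (var i) (var_monom i) =
        Poly_Mapping.lookup (var (Suc i)) (var_monom i)" by simp
    moreover have "var_monom (Suc i) \<noteq> var_monom i"
    proof
      assume "var_monom (Suc i) = var_monom i"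
      then have "Poly_Mapping.lookup (var_monom (Suc i)) i = Poly_Mapping.lookup (var_monom i) i"
        by simp
      then show False by (simp add: var_monom_def lookup_single when_def)
    qed
    ultimately show False
      by (simp add: var_def mpoly_of_monom_def lookup_single when_def)
  qed
  moreover from calculation(1) obtain g where "f - swap_vars i f = (var i - var (Suc i)) * g" ..
  ultimately show ?thesis by (intro ex1I[of _ g]) (simp_all del: right_minus_eq)
qed

lemma divdiff: "(var i - var (Suc i)) * divdiff i f = f - swap_vars i f"
  unfolding divdiff_def by (rule theI'[OF divdiff_ex1])

definition monom_key :: "nat \<Rightarrow> monom \<Rightarrow> nat list"
  where "monom_key n W =
    (\<Sum>k = 1..n - 1. Poly_Mapping.lookup W k) # map (Poly_Mapping.lookup W) (rev [1..<n])"

definition monom_less :: "nat \<Rightarrow> monom \<Rightarrow> monom \<Rightarrow> bool"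
  where "monom_less n U V \<longleftrightarrow> (monom_key n U, monom_key n V) \<in> lexord less_than"

(* Meaningful for nonzero polynomials in the variables x_1, ..., x_{n-1}: see lead_monom_ex1. *)
definition lead_monom :: "nat \<Rightarrow> zpoly \<Rightarrow> monom"
  where "lead_monom n f =
    (THE W. W \<in> Poly_Mapping.keys f \<and> (\<forall>V \<in> Poly_Mapping.keys f. V \<noteq> W \<longrightarrow> monom_less n V W))"

definition monic :: "nat \<Rightarrow> zpoly \<Rightarrow> bool"
  where "monic n f \<longleftrightarrow> f \<noteq> 0 \<and> Poly_Mapping.lookup f (lead_monom n f) = 1"

definition B_x :: "nat \<Rightarrow> monom set"
  where "B_x n = {W. Poly_Mapping.keys W \<subseteq> {1..n - 1} \<and>
    (\<forall>k \<in> {1..n - 1}. Poly_Mapping.lookup W k + k \<le> n)}"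

lemma monom_less_trans: "monom_less n U V \<Longrightarrow> monom_less n V W \<Longrightarrow> monom_less n U W"
  unfolding monom_less_def by (rule lexord_trans) auto

lemma monom_less_irrefl: "\<not> monom_less n U U"
  unfolding monom_less_def by (rule lexord_irreflexive) auto

lemma monom_less_linear:
  assumes "Poly_Mapping.keys U \<subseteq> {1..n - 1}" "Poly_Mapping.keys V \<subseteq> {1..n - 1}" "U \<noteq> V"
  shows "monom_less n U V \<or> monom_less n V U"
proof -
  have "monom_key n U \<noteq> monom_key n V"
  proof
    assume "monom_key n U = monom_key n V"
    then have eq: "Poly_Mapping.lookup U k = Poly_Mapping.lookup V k" if "k \<in> {1..n - 1}" for k
      using that by (auto simp: monom_key_def)
    have "U = V"
    proof (rule poly_mapping_eqI)
      fix k show "Poly_Mapping.lookup U k = Poly_Mapping.lookup V k"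
      proof (cases "k \<in> {1..n - 1}")
        case True
        then show ?thesis by (rule eq)
      next
        case False
        then have "k \<notin> Poly_Mapping.keys U" "k \<notin> Poly_Mapping.keys V"
          using assms(1,2) by blast+
        then show ?thesis by (simp add: in_keys_iff)
      qed
    qed
    with assms show False by simp
  qed
  then show ?thesis
    unfolding monom_less_def using lexord_linear[of less_than "monom_key n U" "monom_key n V"]
    by (auto simp: linorder_less_linear)
qed

lemma lead_monom_ex1:
  assumes "f \<noteq> 0" "\<And>W. W \<in> Poly_Mapping.keys f \<Longrightarrow> Poly_Mapping.keys W \<subseteq> {1..n - 1}"
  shows "\<exists>!W. W \<in> Poly_Mapping.keys f \<and>
    (\<forall>V \<in> Poly_Mapping.keys f. V \<noteq> W \<longrightarrow> monom_less n V W)"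
proof -
  have "\<exists>W \<in> A. \<forall>V \<in> A. V \<noteq> W \<longrightarrow> monom_less n V W"
    if "finite A" "A \<noteq> {}" "A \<subseteq> Poly_Mapping.keys f" for A
    using that
  proof (induction A rule: finite_ne_induct)
    case (singleton W)
    then show ?case by simp
  next
    case (insert U A)
    then obtain W where "W \<in> A" and W: "\<forall>V \<in> A. V \<noteq> W \<longrightarrow> monom_less n V W" by auto
    moreover have "monom_less n U W \<or> monom_less n W U"
      using insert \<open>W \<in> A\<close> assms(2) by (intro monom_less_linear) auto
    ultimately show ?case
    proof (elim disjE)
      assume "monom_less n U W"
      with W \<open>W \<in> A\<close> show ?thesis by (intro bexI[of _ W]) auto
    next
      assume "monom_less n W U"
      with W show ?thesis by (intro bexI[of _ U]) (auto intro: monom_less_trans)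
    qed
  qed
  from this[of "Poly_Mapping.keys f"] assms(1) obtain W where
    W: "W \<in> Poly_Mapping.keys f" "\<forall>V \<in> Poly_Mapping.keys f. V \<noteq> W \<longrightarrow> monom_less n V W"
    by auto
  show ?thesis
  proof (rule ex1I[of _ W])
    fix W' assume W': "W' \<in> Poly_Mapping.keys f \<and>
      (\<forall>V \<in> Poly_Mapping.keys f. V \<noteq> W' \<longrightarrow> monom_less n V W')"
    show "W' = W"
    proof (rule ccontr)
      assume "W' \<noteq> W"
      with W W' have "monom_less n W W'" "monom_less n W' W" by auto
      then show False using monom_less_trans monom_less_irrefl by blast
    qed
  qed (use W in auto)
qed

(* Integer arithmetic, since the difference may be negative. *)
definition M_below :: "(nat \<Rightarrow> nat) \<Rightarrow> nat \<Rightarrow> nat \<Rightarrow> nat \<Rightarrow> nat set"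
  where "M_below i r l q = {j. 1 \<le> j \<and> j < q \<and> int (i r) - int l \<in> {int (i j)..int j}}"

(* Only the values up to the first empty set of candidates are used. *)
primrec q_seq :: "(nat \<Rightarrow> nat) \<Rightarrow> nat \<Rightarrow> nat \<Rightarrow> nat"
  where
    "q_seq i r 0 = r"
  | "q_seq i r (Suc l) = Max (M_below i r (Suc l) (q_seq i r l))"

(* M_set i r l is the set M_{r,l}, for l >= 1. *)
definition M_set :: "(nat \<Rightarrow> nat) \<Rightarrow> nat \<Rightarrow> nat \<Rightarrow> nat set"
  where "M_set i r l = M_below i r l (q_seq i r (l - 1))"

definition m_val :: "(nat \<Rightarrow> nat) \<Rightarrow> nat \<Rightarrow> nat"
  where "m_val i r = (LEAST l. M_set i r (Suc l) = {})"

(* X[1,z] is empty for z <= 0, so truncated subtraction is harmless here. *)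
definition X_monom :: "(nat \<Rightarrow> nat) \<Rightarrow> nat \<Rightarrow> monom"
  where "X_monom i j =
    (\<Sum>k = 1..i j - m_val i j - 1. var_monom k) + (\<Sum>k = 1..m_val i j. var_monom (1 + q_seq i j k))"

definition phi :: "nat \<Rightarrow> (nat \<Rightarrow> nat) \<Rightarrow> monom"
  where "phi n u = (\<Sum>j = 1..n - 1. X_monom (nf_index n u) j)"

end

theory Submission
  imports Defs
begin

text \<open>
  The exponent of \<open>x\<^sub>k\<close> in the leading monomial is the Lehmer-type code
  \<open>c\<^sub>k(u) = |{j. k < j \<le> n, u\<^sup>-\<^sup>1(j) > u\<^sup>-\<^sup>1(k)}|\<close>, from which the bijection onto \<open>B\<^sub>x\<close> and the
  criterion for reducedness can be read off. An operator \<open>\<partial>\<^sub>t\<close> does not preserve leading monomials in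
  general, but it does so along the normal form: after the blocks \<open>n - 1, \<dots>, j + 1\<close> have been applied,
  the part of the polynomial with the largest exponents of \<open>x\<^sub>j\<^sub>+\<^sub>2, \<dots>, x\<^sub>n\<close> is a single monomial with
  strictly decreasing exponents in \<open>x\<^sub>1, \<dots>, x\<^sub>j\<^sub>+\<^sub>1\<close>, and on it block \<open>j\<close> can be followed explicitly.
  Independently, the factor \<open>X\<^sub>r\<close> is the product of the \<open>x\<^sub>k\<close> with \<open>k\<close> in the image of \<open>[1, i\<^sub>r - 1]\<close> under the
  permutation \<open>s\<^sub>1\<^sub>,\<^sub>i\<^sub>1 \<cdots> s\<^sub>r\<^sub>-\<^sub>1\<^sub>,\<^sub>i\<^sub>r\<^sub>-\<^sub>1\<close>, and these products multiply to the monomial of the code.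
\<close>

section \<open>Divided differences as operators\<close>

lemma map_key_transpose_plus:
  "Poly_Mapping.map_key (transpose i (Suc i)) (U + V :: monom) =
    Poly_Mapping.map_key (transpose i (Suc i)) U + Poly_Mapping.map_key (transpose i (Suc i)) V"
  by (rule poly_mapping_eqI) (simp add: map_key.rep_eq lookup_add)

lemma swap_vars_zero [simp]: "swap_vars i 0 = 0"
  by (simp add: swap_vars_def inj_swap_exponents)

lemma swap_vars_swap_vars [simp]: "swap_vars i (swap_vars i f) = f"
  by (rule poly_mapping_eqI)
    (simp add: lookup_swap_vars map_key_compose map_key_id[unfolded id_def[symmetric]] id_def[symmetric])

lemma swap_vars_diff: "swap_vars i (f - g) = swap_vars i f - swap_vars i g"
  by (rule poly_mapping_eqI) (simp add: lookup_swap_vars lookup_minus)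

text \<open>Reduces additive identities to single terms, without the freshness condition of
  \<open>update_induct\<close>.\<close>

lemma poly_mapping_induct_single [case_names zero add]:
  fixes f :: "'a \<Rightarrow>\<^sub>0 'b :: monoid_add"
  assumes "P 0" "\<And>f W c. P f \<Longrightarrow> P (f + Poly_Mapping.single W c)"
  shows "P f"
proof (induction f rule: update_induct)
  case (update f W c)
  have "Poly_Mapping.update W c f = f + Poly_Mapping.single W c"
    using update(1) by (intro poly_mapping_eqI)
      (auto simp: lookup_update lookup_add lookup_single when_def in_keys_iff)
  with update assms(2) show ?case by simp
qed (rule assms(1))

lemma swap_vars_mult: "swap_vars i (f * g) = swap_vars i f * swap_vars i g"
proof (induction f rule: poly_mapping_induct_single)
  case (add f W c)
  have "swap_vars i (Poly_Mapping.single W c * g) = swap_vars i (Poly_Mapping.single W c) * swap_vars i g"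
    by (induction g rule: poly_mapping_induct_single)
      (simp_all add: distrib_left swap_vars_add swap_vars_single mult_single map_key_transpose_plus)
  with add show ?case by (simp add: distrib_right swap_vars_add)
qed simp

lemma swap_vars_var: "swap_vars i (var k) = var (transpose i (Suc i) k)"
proof -
  have "Poly_Mapping.map_key (transpose i (Suc i)) (Poly_Mapping.single k 1 :: monom) =
      Poly_Mapping.single (transpose i (Suc i) k) 1"
    by (rule poly_mapping_eqI)
      (auto simp: map_key.rep_eq lookup_single when_def transpose_def)
  then show ?thesis
    by (simp add: var_def mpoly_of_monom_def var_monom_def swap_vars_single)
qed

lemma var_eq_iff [simp]: "var i = var k \<longleftrightarrow> i = k"
  by (metis inj_on_eq_iff inj_single one_neq_zero UNIV_I mpoly_of_monom_def
      lookup_single_eq lookup_single_not_eq var_def var_monom_def)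

text \<open>Polynomials over the integers have no zero divisors, so the nonzero divisor can be
  cancelled. Values of \<open>divdiff\<close> are identified through this rule.\<close>

lemma divdiff_eqI:
  assumes "(var i - var (Suc i)) * g = f - swap_vars i f"
  shows "divdiff i f = g"
proof -
  have "var i - var (Suc i) \<noteq> 0" by simp
  moreover have "(var i - var (Suc i)) * divdiff i f = (var i - var (Suc i)) * g"
    using assms divdiff[of i f] by simp
  ultimately show ?thesis using mult_left_cancel by blast
qed

lemma divdiff_add: "divdiff i (f + g) = divdiff i f + divdiff i g"
  by (rule divdiff_eqI) (simp add: distrib_left divdiff swap_vars_add)

lemma divdiff_zero [simp]: "divdiff i 0 = 0"
  by (rule divdiff_eqI) simp

lemma divdiff_sum: "divdiff i (sum f A) = (\<Sum>a\<in>A. divdiff i (f a))"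
  by (induction A rule: infinite_finite_induct) (simp_all add: divdiff_add)

lemma divdiff_swap_vars: "divdiff i (swap_vars i f) = - divdiff i f"
  by (rule divdiff_eqI) (simp add: divdiff)

lemma swap_vars_divdiff [simp]: "swap_vars i (divdiff i f) = divdiff i f"
proof -
  have "swap_vars i ((var i - var (Suc i)) * divdiff i f) = swap_vars i f - f"
    by (simp only: divdiff swap_vars_diff swap_vars_swap_vars)
  then have "(var i - var (Suc i)) * swap_vars i (divdiff i f) = f - swap_vars i f"
    by (simp add: swap_vars_mult swap_vars_diff swap_vars_var algebra_simps)
  from divdiff_eqI[OF this] show ?thesis by simp
qed

lemma swap_vars_commute:
  assumes "Suc i < j"
  shows "swap_vars i (swap_vars j f) = swap_vars j (swap_vars i f)"
proof (rule poly_mapping_eqI)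
  fix W :: monom
  have "Poly_Mapping.map_key (transpose j (Suc j)) (Poly_Mapping.map_key (transpose i (Suc i)) W) =
      Poly_Mapping.map_key (transpose i (Suc i)) (Poly_Mapping.map_key (transpose j (Suc j)) W)"
    using assms by (intro poly_mapping_eqI) (auto simp: map_key.rep_eq transpose_def)
  then show "Poly_Mapping.lookup (swap_vars i (swap_vars j f)) W =
      Poly_Mapping.lookup (swap_vars j (swap_vars i f)) W"
    by (simp add: lookup_swap_vars)
qed

lemma swap_vars_braid:
  "swap_vars i (swap_vars (Suc i) (swap_vars i f)) =
    swap_vars (Suc i) (swap_vars i (swap_vars (Suc i) f))"
proof (rule poly_mapping_eqI)
  fix W :: monom
  let ?s = "Poly_Mapping.map_key (transpose i (Suc i)) :: monom \<Rightarrow> monom"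
  let ?r = "Poly_Mapping.map_key (transpose (Suc i) (Suc (Suc i))) :: monom \<Rightarrow> monom"
  have "?s (?r (?s W)) = ?r (?s (?r W))"
    by (intro poly_mapping_eqI) (auto simp: map_key.rep_eq transpose_def)
  then show "Poly_Mapping.lookup (swap_vars i (swap_vars (Suc i) (swap_vars i f))) W =
      Poly_Mapping.lookup (swap_vars (Suc i) (swap_vars i (swap_vars (Suc i) f))) W"
    by (simp add: lookup_swap_vars)
qed

text \<open>Each divisor is fixed by the other interchange, so multiplying by both divisors turns
  either side into the same alternating sum of four interchanged copies of \<open>f\<close>.\<close>

lemma divdiff_commute:
  assumes "Suc i < j"
  shows "divdiff i (divdiff j f) = divdiff j (divdiff i f)"
proof (rule divdiff_eqI)
  let ?x = "var i - var (Suc i)" and ?y = "var j - var (Suc j)"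
  have nz: "?y \<noteq> 0" by simp
  have tx: "swap_vars j ?x = ?x" and ty: "swap_vars i ?y = ?y"
    using assms by (auto simp: swap_vars_diff swap_vars_var transpose_def)
  have "?y * (?x * divdiff j (divdiff i f)) = ?x * divdiff i f - swap_vars j (?x * divdiff i f)"
  proof -
    have "swap_vars j (?x * divdiff i f) = ?x * swap_vars j (divdiff i f)"
      by (simp only: swap_vars_mult tx)
    then show ?thesis
      by (simp only: mult.left_commute[of ?y] divdiff[of j] right_diff_distrib[of ?x])
  qed
  also have "\<dots> = ?y * divdiff j f - swap_vars i (?y * divdiff j f)"
    by (simp only: divdiff) (simp add: swap_vars_diff swap_vars_commute[OF assms])
  also have "\<dots> = ?y * (divdiff j f - swap_vars i (divdiff j f))"
    by (simp only: swap_vars_mult ty right_diff_distrib)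
  finally show "?x * divdiff j (divdiff i f) = divdiff j f - swap_vars i (divdiff j f)"
    using nz mult_left_cancel by blast
qed

text \<open>Multiplied by the Vandermonde product of the three variables, either side becomes the
  signed sum of \<open>f\<close> over their six permutations. The two sums could differ only in the
  term of the longest permutation, which \<open>swap_vars_braid\<close> settles.\<close>

lemma divdiff_braid:
  "divdiff i (divdiff (Suc i) (divdiff i f)) = divdiff (Suc i) (divdiff i (divdiff (Suc i) f))"
proof -
  define a b c where "a = var i" and "b = var (Suc i)" and "c = var (Suc (Suc i))"
  define s r where "s = swap_vars i" and "r = swap_vars (Suc i)"
  have s: "s a = b" "s b = a" "s c = c" and r: "r a = a" "r b = c" "r c = b"
    by (simp_all add: s_def r_def a_def b_def c_def swap_vars_var transpose_def)
  have sd: "s (x - y) = s x - s y" "s (x * y) = s x * s y" and ss: "s (s x) = x" for x y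
    by (simp_all add: s_def swap_vars_diff swap_vars_mult)
  have rd: "r (x - y) = r x - r y" "r (x * y) = r x * r y" and rr: "r (r x) = x" for x y
    by (simp_all add: r_def swap_vars_diff swap_vars_mult)
  have D: "(a - b) * divdiff i x = x - s x" "s (divdiff i x) = divdiff i x"
    and E: "(b - c) * divdiff (Suc i) x = x - r x" "r (divdiff (Suc i) x) = divdiff (Suc i) x" for x
    using divdiff[of i x] divdiff[of "Suc i" x] by (simp_all add: a_def b_def c_def s_def r_def)
  have nz: "(a - b) * (a - c) * (b - c) \<noteq> 0" by (simp add: a_def b_def c_def)
  let ?alt = "f - s f - r f + s (r f) + r (s f)"
  have "(a - b) * (a - c) * (b - c) * divdiff i (divdiff (Suc i) (divdiff i f)) = ?alt - s (r (s f))"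
  proof -
    define g where "g = divdiff i f"
    define h where "h = divdiff (Suc i) g"
    have g: "(a - b) * g = f - s f" "s g = g" by (simp_all add: g_def D)
    \<comment> \<open>Interchanges carry the defining equation of \<open>g\<close> to the other two
      factors of the Vandermonde product.\<close>
    have rg: "(a - c) * r g = r f - r (s f)" using arg_cong[OF g(1), of r] by (simp add: rd r)
    have srg: "(b - c) * s (r g) = s (r f) - s (r (s f))" using arg_cong[OF rg, of s] by (simp add: sd s)
    have h: "(b - c) * h = g - r g" by (simp add: h_def E)
    have sh: "(a - c) * s h = g - s (r g)" using arg_cong[OF h, of s] g(2) by (simp add: sd s)
    have "(a - b) * (a - c) * (b - c) * divdiff i h = (a - c) * (b - c) * ((a - b) * divdiff i h)"
      by (simp add: algebra_simps)
    also have "\<dots> = (a - c) * ((b - c) * h) - (b - c) * ((a - c) * s h)"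
      unfolding D by (simp add: algebra_simps)
    also have "\<dots> = (a - b) * g - (a - c) * r g + (b - c) * s (r g)"
      unfolding h sh by (simp add: algebra_simps)
    finally show ?thesis unfolding g(1) rg srg unfolding h_def g_def by simp
  qed
  moreover have "(a - b) * (a - c) * (b - c) * divdiff (Suc i) (divdiff i (divdiff (Suc i) f)) =
      ?alt - r (s (r f))"
  proof -
    define g where "g = divdiff (Suc i) f"
    define h where "h = divdiff i g"
    have g: "(b - c) * g = f - r f" "r g = g" by (simp_all add: g_def E)
    have sg: "(a - c) * s g = s f - s (r f)" using arg_cong[OF g(1), of s] by (simp add: sd s)
    have rsg: "(a - b) * r (s g) = r (s f) - r (s (r f))" using arg_cong[OF sg, of r] by (simp add: rd r)
    have h: "(a - b) * h = g - s g" by (simp add: h_def D)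
    have rh: "(a - c) * r h = g - r (s g)" using arg_cong[OF h, of r] g(2) by (simp add: rd r)
    have "(a - b) * (a - c) * (b - c) * divdiff (Suc i) h = (a - c) * (a - b) * ((b - c) * divdiff (Suc i) h)"
      by (simp add: algebra_simps)
    also have "\<dots> = (a - c) * ((a - b) * h) - (a - b) * ((a - c) * r h)"
      unfolding E by (simp add: algebra_simps)
    also have "\<dots> = (b - c) * g - (a - c) * s g + (a - b) * r (s g)"
      unfolding h rh by (simp add: algebra_simps)
    finally show ?thesis unfolding g(1) sg rsg unfolding h_def g_def by simp
  qed
  ultimately have "(a - b) * (a - c) * (b - c) * divdiff i (divdiff (Suc i) (divdiff i f)) =
      (a - b) * (a - c) * (b - c) * divdiff (Suc i) (divdiff i (divdiff (Suc i) f))"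
    by (simp add: s_def r_def swap_vars_braid)
  with nz show ?thesis using mult_left_cancel by blast
qed

text \<open>This is the factorisation of \<open>x^d - y^d\<close> for \<open>d = a - b\<close>,
  after extraction of \<open>x^b y^b\<close>. If \<open>b < a\<close>, the summand
  \<open>p = 0\<close> has the largest exponent of \<open>x_(t+1)\<close>, namely
  \<open>a - 1\<close>, and is the leading one.\<close>

lemma divdiff_single:
  assumes "b \<le> a" and R: "Poly_Mapping.lookup R t = 0" "Poly_Mapping.lookup R (Suc t) = 0"
  shows "divdiff t (Poly_Mapping.single (R + Poly_Mapping.single t a + Poly_Mapping.single (Suc t) b) c) =
    (\<Sum>p<a - b. Poly_Mapping.single
      (R + Poly_Mapping.single t (b + p) + Poly_Mapping.single (Suc t) (a - Suc p)) c)"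
proof (rule divdiff_eqI)
  define d where "d = a - b"
  have a: "a = b + d" using assms by (simp add: d_def)
  let ?R = "Poly_Mapping.single R c :: zpoly" and ?x = "var t" and ?y = "var (Suc t)"
  have mon: "Poly_Mapping.single (R + Poly_Mapping.single t k + Poly_Mapping.single (Suc t) l) c =
      ?R * ?x ^ k * ?y ^ l" for k l
    by (simp add: var_power mult_single)
  have "Poly_Mapping.map_key (transpose t (Suc t))
      (R + Poly_Mapping.single t a + Poly_Mapping.single (Suc t) b) =
      R + Poly_Mapping.single t b + Poly_Mapping.single (Suc t) a"
    using R by (intro poly_mapping_eqI)
      (auto simp: map_key.rep_eq lookup_add lookup_single when_def transpose_def)
  then have "swap_vars t (Poly_Mapping.single
      (R + Poly_Mapping.single t a + Poly_Mapping.single (Suc t) b) c) = ?R * ?x ^ b * ?y ^ a"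
    by (subst swap_vars_single) (simp only: mon)
  moreover have "(?x - ?y) * (\<Sum>p<d. ?x ^ p * ?y ^ (d - Suc p)) = ?x ^ d - ?y ^ d"
    by (simp add: power_diff_sumr2 mult.commute)
  then have "?R * ?x ^ b * ?y ^ b * ((?x - ?y) * (\<Sum>p<d. ?x ^ p * ?y ^ (d - Suc p))) =
      ?R * ?x ^ a * ?y ^ b - ?R * ?x ^ b * ?y ^ a"
    by (simp only: a power_add) (simp add: algebra_simps)
  moreover have "(\<Sum>p<a - b. ?R * ?x ^ (b + p) * ?y ^ (a - Suc p)) =
      ?R * ?x ^ b * ?y ^ b * (\<Sum>p<d. ?x ^ p * ?y ^ (d - Suc p))"
  proof -
    have "?R * ?x ^ (b + p) * ?y ^ (a - Suc p) = ?R * ?x ^ b * ?y ^ b * (?x ^ p * ?y ^ (d - Suc p))"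
      if "p < d" for p
    proof -
      have "a - Suc p = b + (d - Suc p)" using that a by simp
      then show ?thesis by (simp only: power_add) (simp add: algebra_simps)
    qed
    then show ?thesis
      unfolding sum_distrib_left d_def[symmetric] by (intro sum.cong) auto
  qed
  ultimately show "(?x - ?y) * (\<Sum>p<a - b. Poly_Mapping.single
      (R + Poly_Mapping.single t (b + p) + Poly_Mapping.single (Suc t) (a - Suc p)) c) =
      Poly_Mapping.single (R + Poly_Mapping.single t a + Poly_Mapping.single (Suc t) b) c -
      swap_vars t (Poly_Mapping.single (R + Poly_Mapping.single t a + Poly_Mapping.single (Suc t) b) c)"
    by (simp only: mon) (simp add: algebra_simps)
qed

section \<open>Lehmer codes of permutations\<close>

lemma desc_word_Suc: "i \<le> Suc j \<Longrightarrow> desc_word (Suc j) i = Suc j # desc_word j i"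
  by (simp add: desc_word_def)

lemma desc_word_empty [simp]: "j < i \<Longrightarrow> desc_word j i = []"
  by (simp add: desc_word_def)

lemma rev_desc_word [simp]: "rev (desc_word j i) = [i..<Suc j]"
  by (simp add: desc_word_def del: upt_Suc)

lemma word_perm_rev_inverse [simp]:
  "word_perm (rev w) (word_perm w x) = x" "word_perm w (word_perm (rev w) x) = x"
  by (induction w arbitrary: x) (simp_all add: word_perm_append)

lemma inv_word_perm: "inv (word_perm w) = word_perm (rev w)"
  by (rule inv_equality) simp_all

lemma bij_word_perm: "bij (word_perm w)"
  by (rule o_bij[of "word_perm (rev w)"]) (simp_all add: fun_eq_iff)

lemma word_perm_desc_word:
  assumes "i \<le> Suc j"
  shows "word_perm (desc_word j i) x =
    (if x < i \<or> Suc j < x then x else if x = i then Suc j else x - 1)"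
  using assms
proof (induction j)
  case 0
  then show ?case by (cases "i = 0") (auto simp: desc_word_def transpose_def)
next
  case (Suc j)
  show ?case
  proof (cases "i = Suc (Suc j)")
    case False
    with Suc.prems have "i \<le> Suc j" by simp
    with Suc.IH show ?thesis by (auto simp: desc_word_Suc transpose_def)
  qed auto
qed

text \<open>The word is the reverse of \<open>desc_word j i\<close> and so represents the inverse
  cycle.\<close>

lemma word_perm_upt:
  assumes "i \<le> Suc j"
  shows "word_perm [i..<Suc j] x =
    (if x < i \<or> Suc j < x then x else if x = Suc j then i else Suc x)"
proof -
  have "word_perm (rev (desc_word j i)) (word_perm (desc_word j i)
      (if x < i \<or> Suc j < x then x else if x = Suc j then i else Suc x)) =
      (if x < i \<or> Suc j < x then x else if x = Suc j then i else Suc x)"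
    by (simp only: word_perm_rev_inverse)
  moreover have "word_perm (desc_word j i)
      (if x < i \<or> Suc j < x then x else if x = Suc j then i else Suc x) = x"
    using assms by (auto simp: word_perm_desc_word)
  ultimately show ?thesis by simp
qed

text \<open>Counts the non-inversions of \<open>v\<close> that start at position \<open>k\<close>.
  Variables begin at index 1, and the value 0 at \<open>k = 0\<close> lets
  \<open>lookup_code\<close> hold at every index.\<close>

definition code_nth :: "nat \<Rightarrow> (nat \<Rightarrow> nat) \<Rightarrow> nat \<Rightarrow> nat"
  where "code_nth n v k = (if k = 0 then 0 else card {j \<in> {k<..n}. v k < v j})"

definition code :: "nat \<Rightarrow> (nat \<Rightarrow> nat) \<Rightarrow> monom"
  where "code n v = (\<Sum>k = 1..n. Poly_Mapping.single k (code_nth n v k))"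

lemma lookup_code [simp]: "Poly_Mapping.lookup (code n v) k = code_nth n v k"
proof -
  have "Poly_Mapping.lookup (code n v) k = (\<Sum>l = 1..n. if k = l then code_nth n v l else 0)"
    by (auto simp: code_def lookup_sum lookup_single when_def intro: sum.cong)
  also have "\<dots> = code_nth n v k"
    by (subst sum.delta') (auto simp: code_nth_def)
  finally show ?thesis .
qed

lemma code_nth_above [simp]: "n \<le> k \<Longrightarrow> code_nth n v k = 0"
  by (simp add: code_nth_def)

lemma code_nth_le: "code_nth n v k \<le> n - k"
proof -
  have "card {j \<in> {k<..n}. v k < v j} \<le> card {k<..n}" by (intro card_mono) auto
  then show ?thesis by (simp add: code_nth_def)
qed

lemma code_nth_id: "k \<noteq> 0 \<Longrightarrow> code_nth n id k = n - k"
proof -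
  assume "k \<noteq> 0"
  moreover have "{j \<in> {k<..n}. id k < id j} = {k<..n}" by auto
  ultimately show ?thesis by (simp add: code_nth_def)
qed

text \<open>Only the pair of positions \<open>t\<close> and \<open>t + 1\<close> changes its
  relative order. The two entries trade places and the larger drops by 1, exactly as
  \<open>x_t^a x_(t+1)^b\<close> with \<open>b < a\<close> passes to the leading monomial
  \<open>x_t^b x_(t+1)^(a-1)\<close> of its divided difference.\<close>

lemma code_nth_transpose:
  assumes "1 \<le> t" "t < n" and v: "v t < v (Suc t)"
  defines "v' \<equiv> v \<circ> transpose t (Suc t)"
  shows "code_nth n v' t = code_nth n v (Suc t)"
    and "code_nth n v t = Suc (code_nth n v' (Suc t))"
    and "k \<noteq> t \<Longrightarrow> k \<noteq> Suc t \<Longrightarrow> code_nth n v' k = code_nth n v k"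
    and "code_nth n v (Suc t) < code_nth n v t"
proof -
  have v': "v' t = v (Suc t)" "v' (Suc t) = v t" "j \<noteq> t \<Longrightarrow> j \<noteq> Suc t \<Longrightarrow> v' j = v j" for j
    by (simp_all add: v'_def transpose_def)
  have "{j \<in> {t<..n}. v' t < v' j} = {j \<in> {Suc t<..n}. v (Suc t) < v j}"
  proof (intro set_eqI iffI)
    fix j assume "j \<in> {j \<in> {t<..n}. v' t < v' j}"
    then show "j \<in> {j \<in> {Suc t<..n}. v (Suc t) < v j}"
      using v v' by (cases "j = Suc t") auto
  qed (use v v' in auto)
  then show "code_nth n v' t = code_nth n v (Suc t)" using assms(1) by (simp add: code_nth_def)
  have *: "{j \<in> {t<..n}. v t < v j} = insert (Suc t) {j \<in> {Suc t<..n}. v t < v j}"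
    using assms by (auto intro: Suc_lessI)
  have "{j \<in> {Suc t<..n}. v' (Suc t) < v' j} = {j \<in> {Suc t<..n}. v t < v j}"
    using v' by auto
  with * show "code_nth n v t = Suc (code_nth n v' (Suc t))"
    using assms(1) by (simp add: code_nth_def)
  have "{j \<in> {Suc t<..n}. v (Suc t) < v j} \<subseteq> {j \<in> {Suc t<..n}. v t < v j}" using v by auto
  then have "card {j \<in> {Suc t<..n}. v (Suc t) < v j} \<le> card {j \<in> {Suc t<..n}. v t < v j}"
    by (intro card_mono) auto
  with * show "code_nth n v (Suc t) < code_nth n v t"
    using assms(1) by (simp add: code_nth_def)
  assume k: "k \<noteq> t" "k \<noteq> Suc t"
  let ?s = "transpose t (Suc t)"
  \<comment> \<open>Either both of \<open>t\<close> and \<open>t + 1\<close> lie beyond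
    \<open>k\<close> or neither does, so the interchange maps \<open>{k<..n}\<close> to
    itself.\<close>
  have "bij_betw ?s {j \<in> {k<..n}. v' k < v' j} {j \<in> {k<..n}. v k < v j}"
    by (rule bij_betw_byWitness[where f' = ?s])
      (use k assms in \<open>auto simp: v'_def transpose_def\<close>)
  then show "code_nth n v' k = code_nth n v k"
    by (simp add: code_nth_def bij_betw_same_card)
qed

text \<open>The variable \<open>x_n\<close> is included so that \<open>\<partial>_(n-1)\<close>,
  too, lowers the degree by exactly one.\<close>

definition deg_upto :: "nat \<Rightarrow> monom \<Rightarrow> nat"
  where "deg_upto n V = (\<Sum>k = 1..n. Poly_Mapping.lookup V k)"

lemma deg_upto_pair:
  assumes "1 \<le> t" "t < n"
  shows "deg_upto n V = Poly_Mapping.lookup V t + Poly_Mapping.lookup V (Suc t) +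
    (\<Sum>k \<in> {1..n} - {t, Suc t}. Poly_Mapping.lookup V k)"
proof -
  have "{1..n} = {t, Suc t} \<union> ({1..n} - {t, Suc t})" using assms by auto
  then have "deg_upto n V = sum (Poly_Mapping.lookup V) ({t, Suc t} \<union> ({1..n} - {t, Suc t}))"
    by (simp add: deg_upto_def)
  also have "\<dots> = sum (Poly_Mapping.lookup V) {t, Suc t} +
      (\<Sum>k \<in> {1..n} - {t, Suc t}. Poly_Mapping.lookup V k)"
    by (rule sum.union_disjoint) auto
  finally show ?thesis by simp
qed

lemma deg_upto_code_transpose:
  assumes "1 \<le> t" "t < n" "v t < v (Suc t)"
  shows "deg_upto n (code n v) = Suc (deg_upto n (code n (v \<circ> transpose t (Suc t))))"
proof -
  have "(\<Sum>k \<in> {1..n} - {t, Suc t}. code_nth n (v \<circ> transpose t (Suc t)) k) =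
      (\<Sum>k \<in> {1..n} - {t, Suc t}. code_nth n v k)"
    using code_nth_transpose(3)[OF assms] by (intro sum.cong) auto
  then show ?thesis
    using code_nth_transpose(1,2)[OF assms] assms by (simp add: deg_upto_pair)
qed

lemma code_nth_eq_imp_eq:
  assumes v: "v permutes {1..n}" and w: "w permutes {1..n}"
    and eq: "\<And>k. k \<in> {1..n} \<Longrightarrow> code_nth n v k = code_nth n w k"
  shows "v = w"
proof -
  have code: "code_nth n p k = card ({p k<..n} - p ` {1..<k})"
    if p: "p permutes {1..n}" and k: "k \<in> {1..n}" for p k
  proof -
    have "p ` {j \<in> {k<..n}. p k < p j} = {p k<..n} - p ` {1..<k}"
    proof (intro set_eqI iffI)
      fix y assume "y \<in> p ` {j \<in> {k<..n}. p k < p j}"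
      then obtain j where j: "y = p j" "j \<in> {1..n}" "k < j" "p k < p j" using k by auto
      then have "y \<in> {1..n}" using permutes_in_image[OF p] by blast
      with j show "y \<in> {p k<..n} - p ` {1..<k}"
        using permutes_inj[OF p] by (auto simp: inj_eq)
    next
      fix y assume y: "y \<in> {p k<..n} - p ` {1..<k}"
      then have "y \<in> p ` {1..n}" using permutes_image[OF p] by auto
      then obtain j where "j \<in> {1..n}" "y = p j" by auto
      with y show "y \<in> p ` {j \<in> {k<..n}. p k < p j}"
        by (cases j k rule: linorder_cases) auto
    qed
    moreover have "inj_on p {j \<in> {k<..n}. p k < p j}"
      using permutes_inj[OF p] by (rule inj_on_subset) simp
    ultimately show ?thesis using k by (auto simp: code_nth_def dest: card_image)
  qed
  have "k \<in> {1..n} \<Longrightarrow> v k = w k" for k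
  proof (induction k rule: less_induct)
    case (less k)
    define A where "A = v ` {1..<k}"
    have A: "A = w ` {1..<k}" using less by (auto simp: A_def intro!: image_cong)
    have notin: "p k \<in> {1..n} - p ` {1..<k}" if "p permutes {1..n}" for p
    proof
      show "p k \<in> {1..n}" using less.prems permutes_in_image[OF that] by blast
      show "p k \<notin> p ` {1..<k}" using permutes_inj[OF that] by (auto simp: inj_eq)
    qed
    have "v k \<in> {1..n} - A" "w k \<in> {1..n} - A"
      using notin[OF v] notin[OF w] by (simp_all only: A_def[symmetric] A[symmetric])
    moreover have "card ({x<..n} - A) > card ({y<..n} - A)"
      if "x < y" "y \<in> {1..n} - A" for x y
      using that by (intro psubset_card_mono) auto
    moreover have "card ({v k<..n} - A) = card ({w k<..n} - A)"
      using code[OF v less.prems] code[OF w less.prems] eq[OF less.prems]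
      unfolding A_def[symmetric] A[symmetric] by simp
    ultimately show ?case by (metis less_irrefl linorder_neqE_nat)
  qed
  moreover have "k \<notin> {1..n} \<Longrightarrow> v k = w k" for k
    using permutes_not_in[OF v] permutes_not_in[OF w] by simp
  ultimately show ?thesis by blast
qed

text \<open>The exponents are chosen independently, with \<open>n - k + 1\<close> possibilities for
  \<open>x_k\<close>. Knowing this number makes injectivity of the code sufficient for its
  bijectivity.\<close>

lemma card_B_x: "card (B_x n) = fact n" if "1 \<le> n"
proof -
  have "bij_betw (\<lambda>W. restrict (Poly_Mapping.lookup W) {1..n - 1}) (B_x n)
      (\<Pi>\<^sub>E k\<in>{1..n - 1}. {..n - k})"
  proof (rule bij_betw_byWitness[where f' = "\<lambda>g. \<Sum>k = 1..n - 1. Poly_Mapping.single k (g k)"])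
    have lk: "Poly_Mapping.lookup (\<Sum>k = 1..n - 1. Poly_Mapping.single k (g k)) j =
        (if j \<in> {1..n - 1} then g j else 0)" for g :: "nat \<Rightarrow> nat" and j
    proof -
      have "Poly_Mapping.lookup (\<Sum>k = 1..n - 1. Poly_Mapping.single k (g k)) j =
          (\<Sum>k = 1..n - 1. if j = k then g k else 0)"
        by (auto simp: lookup_sum lookup_single when_def intro: sum.cong)
      then show ?thesis by (subst (asm) sum.delta') auto
    qed
    show "\<forall>W\<in>B_x n. (\<Sum>k = 1..n - 1. Poly_Mapping.single k
        (restrict (Poly_Mapping.lookup W) {1..n - 1} k)) = W"
    proof
      fix W assume W: "W \<in> B_x n"
      show "(\<Sum>k = 1..n - 1. Poly_Mapping.single k
          (restrict (Poly_Mapping.lookup W) {1..n - 1} k)) = W"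
      proof (rule poly_mapping_eqI)
        fix j
        have "j \<notin> {1..n - 1} \<Longrightarrow> Poly_Mapping.lookup W j = 0"
          using W by (auto simp: B_x_def in_keys_iff subset_iff)
        then show "Poly_Mapping.lookup (\<Sum>k = 1..n - 1. Poly_Mapping.single k
            (restrict (Poly_Mapping.lookup W) {1..n - 1} k)) j = Poly_Mapping.lookup W j"
          unfolding lk by auto
      qed
    qed
    show "\<forall>g\<in>\<Pi>\<^sub>E k\<in>{1..n - 1}. {..n - k}.
        restrict (Poly_Mapping.lookup (\<Sum>k = 1..n - 1. Poly_Mapping.single k (g k))) {1..n - 1} = g"
      unfolding lk by (auto simp: fun_eq_iff PiE_iff extensional_def)
    show "(\<lambda>W. restrict (Poly_Mapping.lookup W) {1..n - 1}) ` B_x n \<subseteq> (\<Pi>\<^sub>E k\<in>{1..n - 1}. {..n - k})"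
      by (auto simp: B_x_def)
    show "(\<lambda>g. \<Sum>k = 1..n - 1. Poly_Mapping.single k (g k)) ` (\<Pi>\<^sub>E k\<in>{1..n - 1}. {..n - k}) \<subseteq> B_x n"
    proof clarify
      fix g assume "g \<in> (\<Pi>\<^sub>E k\<in>{1..n - 1}. {..n - k})"
      then have "g k + k \<le> n" if "k \<in> {1..n - 1}" for k
        using PiE_mem[OF _ that] that by fastforce
      then show "(\<Sum>k = 1..n - 1. Poly_Mapping.single k (g k)) \<in> B_x n"
        unfolding B_x_def subset_iff in_keys_iff mem_Collect_eq lk by auto
    qed
  qed
  then have "card (B_x n) = (\<Prod>k = 1..n - 1. Suc (n - k))"
    by (simp add: bij_betw_same_card card_PiE)
  also have "\<dots> = \<Prod>{2..n}"
    by (rule prod.reindex_bij_witness[of _ "\<lambda>k. Suc n - k" "\<lambda>k. Suc n - k"])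
      (use that in auto)
  also have "\<dots> = fact n"
    using that by (simp add: fact_prod prod.atLeast_Suc_atMost numeral_2_eq_2)
  finally show ?thesis .
qed

lemma bij_betw_code:
  assumes "1 \<le> n"
  shows "bij_betw (\<lambda>u. code n (inv u)) {u. u permutes {1..n}} (B_x n)"
proof -
  have inj: "inj_on (\<lambda>u. code n (inv u)) {u. u permutes {1..n}}"
  proof (rule inj_onI)
    fix u v assume "u \<in> {u. u permutes {1..n}}" "v \<in> {u. u permutes {1..n}}"
      and eq: "code n (inv u) = code n (inv v)"
    then have uv: "u permutes {1..n}" "v permutes {1..n}" by auto
    have "code_nth n (inv u) k = code_nth n (inv v) k" for k
      using arg_cong[OF eq, of "\<lambda>W. Poly_Mapping.lookup W k"] by simp
    then have "inv u = inv v"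
      by (rule code_nth_eq_imp_eq[OF permutes_inv[OF uv(1)] permutes_inv[OF uv(2)]])
    then show "u = v" using uv by (metis permutes_inv_inv)
  qed
  have sub: "(\<lambda>u. code n (inv u)) ` {u. u permutes {1..n}} \<subseteq> B_x n"
  proof clarify
    fix u :: "nat \<Rightarrow> nat"
    have "code_nth n (inv u) k + k \<le> n" if "k \<in> {1..n - 1}" for k
      using code_nth_le[of n "inv u" k] that by auto
    moreover have "k \<in> {1..n - 1}" if "code_nth n (inv u) k \<noteq> 0" for k
      using that code_nth_above[of n k] by (cases "k = 0") (auto simp: code_nth_def not_le)
    ultimately show "code n (inv u) \<in> B_x n" by (auto simp: B_x_def in_keys_iff)
  qed
  have "finite (B_x n)" using card_B_x[OF assms] card_ge_0_finite by (metis fact_gt_zero)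
  moreover have "card {u. u permutes {1..n}} = card (B_x n)"
    using card_permutations[OF refl, of "{1..n}"] card_B_x[OF assms] by simp
  ultimately have "(\<lambda>u. code n (inv u)) ` {u. u permutes {1..n}} = B_x n"
    using card_image[OF inj] card_subset_eq sub by metis
  with inj show ?thesis by (simp add: bij_betw_def)
qed

section \<open>Leading monomials under divided differences\<close>

lemma divdiff_word_Nil [simp]: "divdiff_word [] f = f"
  and divdiff_word_Cons [simp]: "divdiff_word (a # w) f = divdiff a (divdiff_word w f)"
  by (simp_all add: divdiff_word_def)

lemma monom_split_pair:
  obtains R where "Poly_Mapping.lookup R t = 0" "Poly_Mapping.lookup R (Suc t) = 0"
    "W = R + Poly_Mapping.single t (Poly_Mapping.lookup W t) +
      Poly_Mapping.single (Suc t) (Poly_Mapping.lookup W (Suc t) :: nat)"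
proof
  let ?R = "W - Poly_Mapping.single t (Poly_Mapping.lookup W t) -
    Poly_Mapping.single (Suc t) (Poly_Mapping.lookup W (Suc t))"
  show "Poly_Mapping.lookup ?R t = 0" "Poly_Mapping.lookup ?R (Suc t) = 0"
    by (simp_all add: lookup_minus lookup_single when_def)
  show "W = ?R + Poly_Mapping.single t (Poly_Mapping.lookup W t) +
      Poly_Mapping.single (Suc t) (Poly_Mapping.lookup W (Suc t))"
    by (rule poly_mapping_eqI) (auto simp: lookup_add lookup_minus lookup_single when_def)
qed

text \<open>An upper bound for the monomials of \<open>\<partial>_t W\<close>. It depends on the
  exponents of \<open>W\<close> at \<open>t\<close> and \<open>t + 1\<close> only through their sum
  and maximum, so it serves both orders of the two. The bound at \<open>t + 1\<close> is what keeps
  smaller monomials below the leading one.\<close>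

definition divdiff_support :: "nat \<Rightarrow> monom \<Rightarrow> monom set"
  where "divdiff_support t W = {V.
    (\<forall>k. k \<noteq> t \<longrightarrow> k \<noteq> Suc t \<longrightarrow> Poly_Mapping.lookup V k = Poly_Mapping.lookup W k) \<and>
    Suc (Poly_Mapping.lookup V t + Poly_Mapping.lookup V (Suc t)) =
      Poly_Mapping.lookup W t + Poly_Mapping.lookup W (Suc t) \<and>
    Poly_Mapping.lookup V (Suc t) < max (Poly_Mapping.lookup W t) (Poly_Mapping.lookup W (Suc t))}"

lemma keys_divdiff_single: "Poly_Mapping.keys (divdiff t (Poly_Mapping.single W c)) \<subseteq> divdiff_support t W"
proof -
  have *: "Poly_Mapping.keys (divdiff t (Poly_Mapping.single W c)) \<subseteq> divdiff_support t W"
    if le: "Poly_Mapping.lookup W (Suc t) \<le> Poly_Mapping.lookup W t" for W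
  proof -
    obtain R where R: "Poly_Mapping.lookup R t = 0" "Poly_Mapping.lookup R (Suc t) = 0" and
      W: "W = R + Poly_Mapping.single t (Poly_Mapping.lookup W t) +
        Poly_Mapping.single (Suc t) (Poly_Mapping.lookup W (Suc t))"
      by (rule monom_split_pair)
    define a b where "a = Poly_Mapping.lookup W t" and "b = Poly_Mapping.lookup W (Suc t)"
    have W: "W = R + Poly_Mapping.single t a + Poly_Mapping.single (Suc t) b" and "b \<le> a"
      using W le by (simp_all add: a_def b_def)
    have "divdiff t (Poly_Mapping.single W c) = (\<Sum>p<a - b. Poly_Mapping.single
        (R + Poly_Mapping.single t (b + p) + Poly_Mapping.single (Suc t) (a - Suc p)) c)"
      unfolding W using divdiff_single[OF \<open>b \<le> a\<close> R] .
    also have "Poly_Mapping.keys \<dots> \<subseteq> (\<Union>p<a - b. Poly_Mapping.keys (Poly_Mapping.single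
        (R + Poly_Mapping.single t (b + p) + Poly_Mapping.single (Suc t) (a - Suc p)) c))"
      by (rule keys_sum)
    also have "\<dots> \<subseteq> divdiff_support t W"
      by (auto simp: divdiff_support_def W R lookup_add lookup_single when_def split: if_splits)
    finally show ?thesis .
  qed
  show ?thesis
  proof (cases "Poly_Mapping.lookup W (Suc t) \<le> Poly_Mapping.lookup W t")
    case False
    \<comment> \<open>Interchanging the two exponents only changes the sign of the divided
      difference, hence not its monomials.\<close>
    define W' where "W' = Poly_Mapping.map_key (transpose t (Suc t)) W"
    have "Poly_Mapping.lookup W' k = Poly_Mapping.lookup W (transpose t (Suc t) k)" for k
      by (simp add: W'_def map_key.rep_eq)
    then have W': "Poly_Mapping.lookup W' t = Poly_Mapping.lookup W (Suc t)"
        "Poly_Mapping.lookup W' (Suc t) = Poly_Mapping.lookup W t"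
        "k \<noteq> t \<Longrightarrow> k \<noteq> Suc t \<Longrightarrow> Poly_Mapping.lookup W' k = Poly_Mapping.lookup W k" for k
      by (simp_all add: transpose_def)
    have "divdiff t (Poly_Mapping.single W' c) = - divdiff t (Poly_Mapping.single W c)"
      using divdiff_swap_vars[of t "Poly_Mapping.single W c"] by (simp add: swap_vars_single W'_def)
    then have "Poly_Mapping.keys (divdiff t (Poly_Mapping.single W c)) =
        Poly_Mapping.keys (divdiff t (Poly_Mapping.single W' c))" by simp
    also have "\<dots> \<subseteq> divdiff_support t W'" using False W' by (intro *) simp
    also have "\<dots> = divdiff_support t W" using W' by (auto simp: divdiff_support_def)
    finally show ?thesis .
  qed (rule *)
qed

text \<open>Only the summand \<open>p = 0\<close> of \<open>divdiff_single\<close> equals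
  \<open>V\<close>, so the coefficient is passed on unchanged.\<close>

lemma lookup_divdiff_single:
  assumes lt: "Poly_Mapping.lookup W (Suc t) < Poly_Mapping.lookup W t"
    and V: "V \<in> divdiff_support t W" "Poly_Mapping.lookup W t = Suc (Poly_Mapping.lookup V (Suc t))"
  shows "Poly_Mapping.lookup (divdiff t (Poly_Mapping.single W c)) V = c"
proof -
  obtain R where R: "Poly_Mapping.lookup R t = 0" "Poly_Mapping.lookup R (Suc t) = 0" and
    W: "W = R + Poly_Mapping.single t (Poly_Mapping.lookup W t) +
      Poly_Mapping.single (Suc t) (Poly_Mapping.lookup W (Suc t))"
    by (rule monom_split_pair)
  define a b where "a = Poly_Mapping.lookup W t" and "b = Poly_Mapping.lookup W (Suc t)"
  define g where "g p = R + Poly_Mapping.single t (b + p) + Poly_Mapping.single (Suc t) (a - Suc p)" for p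
  have W: "W = R + Poly_Mapping.single t a + Poly_Mapping.single (Suc t) b" and "b \<le> a" "0 < a - b"
    using W lt by (simp_all add: a_def b_def)
  have lV: "Poly_Mapping.lookup V k = Poly_Mapping.lookup R k" if "k \<noteq> t" "k \<noteq> Suc t" for k
    using V that by (simp add: divdiff_support_def W lookup_add lookup_single when_def)
  have g0: "V = g 0"
  proof (rule poly_mapping_eqI)
    fix k show "Poly_Mapping.lookup V k = Poly_Mapping.lookup (g 0) k"
      using V lV[of k] R by (auto simp: g_def divdiff_support_def lookup_add lookup_single when_def
        a_def[symmetric] b_def[symmetric])
  qed
  have "Poly_Mapping.lookup (g p) t = b + p" for p
    by (simp add: g_def R lookup_add lookup_single)
  then have g: "g p = V \<longleftrightarrow> p = 0" for p unfolding g0 by (metis add_cancel_right_right)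
  have "divdiff t (Poly_Mapping.single W c) = (\<Sum>p<a - b. Poly_Mapping.single (g p) c)"
    unfolding W g_def using divdiff_single[OF \<open>b \<le> a\<close> R] .
  then have "Poly_Mapping.lookup (divdiff t (Poly_Mapping.single W c)) V =
      (\<Sum>p<a - b. if p = 0 then c else 0)"
    by (auto simp: lookup_sum lookup_single when_def g intro: sum.cong)
  also have "\<dots> = c" using \<open>0 < a - b\<close> by simp
  finally show ?thesis .
qed

text \<open>The lexicographic part of the monomial order, restricted to comparisons decided beyond
  \<open>x_j\<close>. An operator \<open>\<partial>_t\<close> with \<open>t < j\<close> leaves those
  exponents alone.\<close>

definition lex_below :: "nat \<Rightarrow> monom \<Rightarrow> monom \<Rightarrow> bool"
  where "lex_below j V W \<longleftrightarrow> (\<exists>p>j. Poly_Mapping.lookup V p < Poly_Mapping.lookup W p \<and>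
    (\<forall>q>p. Poly_Mapping.lookup V q = Poly_Mapping.lookup W q))"

text \<open>Comparisons decided at \<open>x_t\<close> are kept apart because
  \<open>\<partial>_t\<close> changes this exponent; the operator shifts the deciding variable to
  \<open>x_(t+1)\<close>.\<close>

definition below_at :: "nat \<Rightarrow> monom \<Rightarrow> monom \<Rightarrow> bool"
  where "below_at t V W \<longleftrightarrow> Poly_Mapping.lookup V t < Poly_Mapping.lookup W t \<and>
    (\<forall>q>t. Poly_Mapping.lookup V q = Poly_Mapping.lookup W q)"

lemma lex_below_mono: "lex_below j V W \<Longrightarrow> k \<le> j \<Longrightarrow> lex_below k V W"
  unfolding lex_below_def using le_less_trans by blast

lemma below_at_imp_lex_below: "below_at t V W \<Longrightarrow> k < t \<Longrightarrow> lex_below k V W"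
  unfolding lex_below_def below_at_def by blast

text \<open>The relation \<open>P\<close> stands in for the monomial order, as only certain
  comparisons survive within a block. Homogeneity is recorded because the order compares degrees
  first.\<close>

definition leads :: "nat \<Rightarrow> (monom \<Rightarrow> monom \<Rightarrow> bool) \<Rightarrow> zpoly \<Rightarrow> monom \<Rightarrow> bool"
  where "leads n P f W \<longleftrightarrow> Poly_Mapping.lookup f W = 1 \<and>
    (\<forall>V \<in> Poly_Mapping.keys f. deg_upto n V = deg_upto n W \<and> (V = W \<or> P V W))"

lemma leads_mono:
  assumes "leads n P f W" "\<And>V. P V W \<Longrightarrow> Q V W"
  shows "leads n Q f W"
  using assms by (auto simp: leads_def)

lemma leads_single: "leads n P (Poly_Mapping.single W 1) W"
  by (simp add: leads_def lookup_single)

lemma sum_single_lookup: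
  "(\<Sum>V\<in>Poly_Mapping.keys f. Poly_Mapping.single V (Poly_Mapping.lookup f V)) = f"
proof (rule poly_mapping_eqI)
  fix U
  have "Poly_Mapping.lookup (\<Sum>V\<in>Poly_Mapping.keys f. Poly_Mapping.single V (Poly_Mapping.lookup f V)) U =
      (\<Sum>V\<in>Poly_Mapping.keys f. if U = V then Poly_Mapping.lookup f V else 0)"
    by (auto simp: lookup_sum lookup_single when_def intro: sum.cong)
  also have "\<dots> = Poly_Mapping.lookup f U"
    by (subst sum.delta') (auto simp: in_keys_iff)
  finally show "Poly_Mapping.lookup (\<Sum>V\<in>Poly_Mapping.keys f.
    Poly_Mapping.single V (Poly_Mapping.lookup f V)) U = Poly_Mapping.lookup f U" .
qed

text \<open>A comparison decided beyond \<open>x_(j+1)\<close> is not affected by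
  \<open>\<partial>_t\<close>. If \<open>V\<close> is below \<open>W\<close> at \<open>t\<close>,
  then both exponents of \<open>V\<close> at \<open>t\<close> and \<open>t + 1\<close> are less than
  that of \<open>W\<close> at \<open>t\<close>, so every monomial of \<open>\<partial>_t V\<close>
  has a smaller exponent at \<open>t + 1\<close> than \<open>W'\<close>. Thus nothing can cancel
  \<open>W'\<close>.\<close>

lemma leads_divdiff:
  assumes f: "leads n (\<lambda>V W. lex_below (Suc j) V W \<or> below_at t V W) f W"
    and t: "1 \<le> t" "t \<le> j" "t < n"
    and lt: "Poly_Mapping.lookup W (Suc t) < Poly_Mapping.lookup W t"
    and W': "Poly_Mapping.lookup W' t = Poly_Mapping.lookup W (Suc t)"
      "Poly_Mapping.lookup W t = Suc (Poly_Mapping.lookup W' (Suc t))"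
      "\<And>k. k \<noteq> t \<Longrightarrow> k \<noteq> Suc t \<Longrightarrow> Poly_Mapping.lookup W' k = Poly_Mapping.lookup W k"
  shows "leads n (\<lambda>V W. lex_below (Suc j) V W \<or> below_at (Suc t) V W) (divdiff t f) W'"
proof -
  let ?P = "\<lambda>V W. lex_below (Suc j) V W \<or> below_at (Suc t) V W"
  define F where "F V = divdiff t (Poly_Mapping.single V (Poly_Mapping.lookup f V))" for V
  have "divdiff t f = divdiff t (\<Sum>V\<in>Poly_Mapping.keys f. Poly_Mapping.single V (Poly_Mapping.lookup f V))"
    by (simp only: sum_single_lookup)
  then have expand: "divdiff t f = (\<Sum>V\<in>Poly_Mapping.keys f. F V)"
    by (simp only: divdiff_sum F_def)
  have W'_supp: "W' \<in> divdiff_support t W" using W' lt by (simp add: divdiff_support_def)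
  have deg: "Suc (deg_upto n U) = deg_upto n V" if "U \<in> divdiff_support t V" for U V
  proof -
    have "(\<Sum>k \<in> {1..n} - {t, Suc t}. Poly_Mapping.lookup U k) =
        (\<Sum>k \<in> {1..n} - {t, Suc t}. Poly_Mapping.lookup V k)"
      using that by (intro sum.cong) (auto simp: divdiff_support_def)
    then show ?thesis using that t by (simp add: deg_upto_pair divdiff_support_def)
  qed
  have lex: "?P U W'" if "V \<in> Poly_Mapping.keys f" "V \<noteq> W" "U \<in> divdiff_support t V" for U V
  proof -
    have "lex_below (Suc j) V W \<or> below_at t V W" using f that by (auto simp: leads_def)
    then show ?thesis
    proof
      assume "lex_below (Suc j) V W"
      then obtain p where p: "Suc j < p" "Poly_Mapping.lookup V p < Poly_Mapping.lookup W p"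
        "\<And>q. q > p \<Longrightarrow> Poly_Mapping.lookup V q = Poly_Mapping.lookup W q"
        by (auto simp: lex_below_def)
      then have "lex_below (Suc j) U W'"
        using that(3) t W'(3) by (auto simp: lex_below_def divdiff_support_def intro!: exI[of _ p])
      then show ?thesis ..
    next
      assume "below_at t V W"
      then have "below_at (Suc t) U W'"
        using that(3) lt W'(2,3) by (auto simp: below_at_def divdiff_support_def)
      then show ?thesis ..
    qed
  qed
  have irrefl: "\<not> ?P W' W'" by (auto simp: lex_below_def below_at_def)
  have keysF: "Poly_Mapping.keys (F V) \<subseteq> divdiff_support t V" for V
    unfolding F_def by (rule keys_divdiff_single)
  have W: "W \<in> Poly_Mapping.keys f" "Poly_Mapping.lookup f W = 1"
    using f by (auto simp: leads_def in_keys_iff)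
  \<comment> \<open>All monomials arising from \<open>V\<close> lie strictly below
    \<open>W'\<close>, so the coefficient of \<open>W'\<close> comes from \<open>W\<close>
    alone.\<close>
  have "Poly_Mapping.lookup (F V) W' = 0" if "V \<in> Poly_Mapping.keys f - {W}" for V
    using lex[of V W'] keysF[of V] irrefl that by (auto simp: in_keys_iff)
  then have "Poly_Mapping.lookup (divdiff t f) W' = Poly_Mapping.lookup (F W) W'"
    using W(1) by (simp add: expand sum.remove[of _ W] lookup_add lookup_sum)
  also have "\<dots> = 1"
    using lookup_divdiff_single[OF lt W'_supp W'(2)] W(2) by (simp add: F_def)
  finally have lead: "Poly_Mapping.lookup (divdiff t f) W' = 1" .
  have "deg_upto n U = deg_upto n W' \<and> (U = W' \<or> ?P U W')" if "U \<in> Poly_Mapping.keys (divdiff t f)" for U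
  proof -
    have "U \<in> (\<Union>V\<in>Poly_Mapping.keys f. Poly_Mapping.keys (F V))"
      using that keys_sum[of F "Poly_Mapping.keys f"] by (auto simp: expand)
    then obtain V where V: "V \<in> Poly_Mapping.keys f" "U \<in> divdiff_support t V"
      using keysF by blast
    have "deg_upto n V = deg_upto n W" using f V by (auto simp: leads_def)
    then have "deg_upto n U = deg_upto n W'" using deg[OF V(2)] deg[OF W'_supp] by simp
    moreover have "U = W' \<or> ?P U W'"
    proof (cases "V = W")
      case True
      have "U = W' \<or> below_at (Suc t) U W'"
      proof (cases "Poly_Mapping.lookup U (Suc t) = Poly_Mapping.lookup W' (Suc t)")
        case eq: True
        \<comment> \<open>The exponents away from \<open>t\<close> agree, and the one at
          \<open>t\<close> is then forced by the degree.\<close>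
        have "U = W'"
        proof (rule poly_mapping_eqI)
          fix k show "Poly_Mapping.lookup U k = Poly_Mapping.lookup W' k"
            using V(2) W' eq True by (cases "k = t \<or> k = Suc t") (auto simp: divdiff_support_def)
        qed
        then show ?thesis ..
      next
        case False
        then show ?thesis using V(2) W' lt True by (auto simp: divdiff_support_def below_at_def)
      qed
      then show ?thesis by blast
    qed (use lex V in blast)
    ultimately show ?thesis ..
  qed
  with lead show ?thesis by (auto simp: leads_def)
qed

text \<open>The order looks at \<open>x_1, ..., x_(n-1)\<close> only. As \<open>W\<close> has
  exponent 0 from \<open>x_n\<close> on, the deciding index is less than \<open>n\<close>; hence the
  exponents of \<open>x_n\<close> agree and equality of degrees passes to the restricted
  degrees.\<close>

lemma monom_less_if_lex_below:
  assumes "lex_below 0 V W" "deg_upto n V = deg_upto n W"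
    and W: "\<And>k. n \<le> k \<Longrightarrow> Poly_Mapping.lookup W k = 0"
  shows "monom_less n V W"
proof -
  obtain p where p: "0 < p" "Poly_Mapping.lookup V p < Poly_Mapping.lookup W p"
    "\<And>q. q > p \<Longrightarrow> Poly_Mapping.lookup V q = Poly_Mapping.lookup W q"
    using assms(1) by (auto simp: lex_below_def)
  have "p < n" using p(2) W by (metis not_less not_less_zero)
  have "{1..n} = insert n {1..n - 1}" using \<open>p < n\<close> by auto
  then have deg: "deg_upto n U = Poly_Mapping.lookup U n + (\<Sum>k = 1..n - 1. Poly_Mapping.lookup U k)" for U
    using \<open>p < n\<close> by (simp add: deg_upto_def)
  have "Poly_Mapping.lookup V n = Poly_Mapping.lookup W n" using p(3) \<open>p < n\<close> by simp
  then have "(\<Sum>k = 1..n - 1. Poly_Mapping.lookup V k) = (\<Sum>k = 1..n - 1. Poly_Mapping.lookup W k)"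
    using assms(2) by (simp add: deg)
  moreover have "rev [1..<n] = rev [Suc p..<n] @ p # rev [1..<p]"
    using p(1) \<open>p < n\<close> upt_add_eq_append[of 1 p "n - p"] by (simp add: upt_conv_Cons)
  moreover have "map (Poly_Mapping.lookup V) (rev [Suc p..<n]) = map (Poly_Mapping.lookup W) (rev [Suc p..<n])"
    using p(3) by (intro map_cong) auto
  ultimately have "monom_key n U = ((\<Sum>k = 1..n - 1. Poly_Mapping.lookup W k) #
      map (Poly_Mapping.lookup W) (rev [Suc p..<n])) @ Poly_Mapping.lookup U p #
      map (Poly_Mapping.lookup U) (rev [1..<p])" if "U = V \<or> U = W" for U
    using that unfolding monom_key_def by (elim disjE) (simp_all only: map_append list.map append_Cons)
  then show ?thesis
    using p(2) by (simp add: monom_less_def lexord_append_left_rightI del: append_Cons)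
qed

lemma lead_monom_eqI:
  assumes "leads n (lex_below 0) f W" "\<And>k. n \<le> k \<Longrightarrow> Poly_Mapping.lookup W k = 0"
  shows "lead_monom n f = W" "monic n f"
proof -
  have key: "W \<in> Poly_Mapping.keys f" using assms by (simp add: leads_def in_keys_iff)
  have less: "monom_less n V W" if "V \<in> Poly_Mapping.keys f" "V \<noteq> W" for V
    using assms that by (auto simp: leads_def intro!: monom_less_if_lex_below)
  show lead: "lead_monom n f = W"
    unfolding lead_monom_def
  proof (rule the_equality)
    fix U assume "U \<in> Poly_Mapping.keys f \<and> (\<forall>V\<in>Poly_Mapping.keys f. V \<noteq> U \<longrightarrow> monom_less n V U)"
    with key less show "U = W" by (metis monom_less_irrefl monom_less_trans)
  qed (use key less in blast)
  show "monic n f" using assms(1) lead by (auto simp: monic_def leads_def)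
qed

section \<open>Normal forms and reduced words\<close>

text \<open>
  The invariant inside block \<open>j\<close>, when \<open>\<partial>\<^sub>t\<close> is the next operator. Among the monomials that agree with the
  leading one beyond \<open>x\<^sub>t\<close>, the leading one has the largest exponent of \<open>x\<^sub>t\<close>; without this, \<open>\<partial>\<^sub>t\<close> could
  turn a smaller monomial into the leading one.
\<close>

definition block_state :: "nat \<Rightarrow> nat list \<Rightarrow> nat \<Rightarrow> nat \<Rightarrow> bool"
  where "block_state n w j t \<longleftrightarrow> (let v = word_perm (rev w) in
    strict_mono_on ({1..Suc j} - {t}) v \<and> (\<forall>k \<in> {t<..Suc j}. v t < v k) \<and>
    length w + deg_upto n (code n v) = deg_upto n (code n id) \<and>
    leads n (\<lambda>V W. lex_below (Suc j) V W \<or> below_at t V W) (divdiff_word w (schubert_top n)) (code n v))"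

text \<open>The value \<open>v t\<close> is smaller than its successors up to \<open>j + 1\<close>,
  so \<open>t\<close> is an ascent and the code changes as in \<open>leads_divdiff\<close>. The
  interchange moves this small value one place to the right.\<close>

lemma block_state_step:
  assumes st: "block_state n w j t" and t: "1 \<le> t" "t \<le> j" "j < n"
  shows "block_state n (t # w) j (Suc t)"
proof -
  define v where "v = word_perm (rev w)"
  define v' where "v' = v \<circ> transpose t (Suc t)"
  have mono: "strict_mono_on ({1..Suc j} - {t}) v" and min: "\<And>k. k \<in> {t<..Suc j} \<Longrightarrow> v t < v k"
    and len: "length w + deg_upto n (code n v) = deg_upto n (code n id)"
    and leads: "leads n (\<lambda>V W. lex_below (Suc j) V W \<or> below_at t V W)
      (divdiff_word w (schubert_top n)) (code n v)"
    using st by (simp_all add: block_state_def Let_def v_def)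
  have tn: "t < n" using t by simp
  have lt: "v t < v (Suc t)" using min[of "Suc t"] t by simp
  have v': "word_perm (rev (t # w)) = v'" by (simp add: v_def v'_def word_perm_append)
  have v'_simps: "v' t = v (Suc t)" "v' (Suc t) = v t" "k \<noteq> t \<Longrightarrow> k \<noteq> Suc t \<Longrightarrow> v' k = v k" for k
    by (simp_all add: v'_def transpose_def)
  have "strict_mono_on ({1..Suc j} - {Suc t}) v'"
  proof (rule strict_mono_onI)
    fix x y assume xy: "x \<in> {1..Suc j} - {Suc t}" "y \<in> {1..Suc j} - {Suc t}" "x < y"
    let ?s = "transpose t (Suc t)"
    \<comment> \<open>Away from \<open>t + 1\<close> the interchange is increasing, and its values
      avoid \<open>t\<close>.\<close>
    have "?s x \<in> {1..Suc j} - {t}" "?s y \<in> {1..Suc j} - {t}" "?s x < ?s y"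
      using xy t by (auto simp: transpose_def)
    then show "v' x < v' y" using mono by (simp add: v'_def strict_mono_onD)
  qed
  moreover have "v' (Suc t) < v' k" if "k \<in> {Suc t<..Suc j}" for k
    using that min[of k] v'_simps(3)[of k] by (auto simp: v'_simps(2))
  moreover have "length (t # w) + deg_upto n (code n v') = deg_upto n (code n id)"
    using len deg_upto_code_transpose[OF t(1) tn, of v] lt by (simp add: v'_def)
  moreover have "leads n (\<lambda>V W. lex_below (Suc j) V W \<or> below_at (Suc t) V W)
      (divdiff t (divdiff_word w (schubert_top n))) (code n v')"
    using code_nth_transpose[OF t(1) tn, of v] lt
    by (intro leads_divdiff[OF leads t(1,2) tn]) (simp_all add: v'_def)
  ultimately show ?thesis unfolding block_state_def v' Let_def by simp
qed

text \<open>A descending word acts with its smallest letter first, so \<open>t\<close> climbs from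
  \<open>i\<close>; at \<open>t = i\<close> the word is still empty.\<close>

lemma block_state_desc_word:
  assumes "block_state n w j i" "1 \<le> i" "i \<le> t" "t \<le> Suc j" "j < n"
  shows "block_state n (desc_word (t - 1) i @ w) j t"
  using assms(3,4)
proof (induction t rule: nat_induct_at_least)
  case base
  then show ?case using assms(1,2) by simp
next
  case (Suc t)
  have "desc_word t i = t # desc_word (t - 1) i"
    using Suc.hyps assms(2) desc_word_Suc[of i "t - 1"] by simp
  then show ?case using block_state_step[of n _ j t] Suc assms by simp
qed

text \<open>The invariant between blocks, once blocks \<open>n - 1, ..., j + 1\<close> have acted.
  An increasing \<open>v\<close> on \<open>{1..Suc j}\<close> means strictly decreasing exponents of
  the leading monomial there.\<close>

definition block_start :: "nat \<Rightarrow> nat list \<Rightarrow> nat \<Rightarrow> bool"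
  where "block_start n w j \<longleftrightarrow> (let v = word_perm (rev w) in
    strict_mono_on {1..Suc j} v \<and>
    length w + deg_upto n (code n v) = deg_upto n (code n id) \<and>
    leads n (lex_below (Suc j)) (divdiff_word w (schubert_top n)) (code n v))"

lemma block_start_imp_state:
  assumes "block_start n w j" "1 \<le> i"
  shows "block_state n w j i"
proof -
  have "word_perm (rev w) i < word_perm (rev w) k" if "k \<in> {i<..Suc j}" for k
    using assms that strict_mono_onD[of "{1..Suc j}" "word_perm (rev w)" i k]
    by (simp add: block_start_def Let_def)
  moreover have "strict_mono_on ({1..Suc j} - {i}) (word_perm (rev w))"
    using assms by (auto simp: block_start_def Let_def strict_mono_on_def)
  ultimately show ?thesis
    using assms by (auto simp: block_start_def block_state_def Let_def intro: leads_mono)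
qed

text \<open>After block \<open>j + 1\<close> the exceptional position is \<open>j + 2\<close>,
  outside the range of the next block, and both kinds of comparison are decided beyond
  \<open>x_(j+1)\<close>.\<close>

lemma block_state_imp_start:
  assumes "block_state n w (Suc j) (Suc (Suc j))"
  shows "block_start n w j"
proof -
  have "{1..Suc (Suc j)} - {Suc (Suc j)} = {1..Suc j}" by auto
  moreover have "lex_below (Suc j) V W"
    if "lex_below (Suc (Suc j)) V W \<or> below_at (Suc (Suc j)) V W" for V W
    using that by (auto intro: lex_below_mono below_at_imp_lex_below)
  ultimately show ?thesis
    using assms by (auto simp: block_start_def block_state_def Let_def intro: leads_mono)
qed

lemma schubert_top_eq: "schubert_top n = Poly_Mapping.single (code n id) 1"
proof -
  have single: "(\<Prod>k\<in>A. Poly_Mapping.single (g k) (1 :: int)) = Poly_Mapping.single (sum g A) 1"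
    for g :: "nat \<Rightarrow> monom" and A
    by (induction A rule: infinite_finite_induct) (simp_all add: mult_single)
  have "(\<Sum>k = 1..n - 1. Poly_Mapping.single k (n - k)) = code n id"
    unfolding code_def
    by (rule sum.mono_neutral_cong_left) (auto simp: code_nth_id)
  then show ?thesis by (simp add: schubert_top_def var_power single)
qed

lemma block_start_suffix:
  assumes i: "i \<in> index_seqs n" and "j < n"
  shows "block_start n (concat (map (\<lambda>j. desc_word j (i j)) [Suc j..<n])) j"
  using assms(2)
proof (induction "n - Suc j" arbitrary: j)
  case 0
  then show ?case
    by (auto simp: block_start_def Let_def schubert_top_eq leads_single strict_mono_on_def)
next
  case (Suc d)
  let ?w = "\<lambda>j. concat (map (\<lambda>j. desc_word j (i j)) [Suc j..<n])"
  have j: "Suc j < n" using Suc by simp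
  then have ij: "1 \<le> i (Suc j)" "i (Suc j) \<le> Suc (Suc j)"
    using i by (auto simp: index_seqs_def PiE_iff)
  have "block_start n (?w (Suc j)) (Suc j)" using Suc j by (intro Suc.hyps) auto
  then have "block_state n (desc_word (Suc (Suc j) - 1) (i (Suc j)) @ ?w (Suc j)) (Suc j) (Suc (Suc j))"
    using ij j by (intro block_state_desc_word block_start_imp_state) auto
  moreover have "?w j = desc_word (Suc j) (i (Suc j)) @ ?w (Suc j)"
    using j by (simp add: upt_conv_Cons)
  ultimately show ?case by (intro block_state_imp_start) simp
qed

lemma block_start_nf_word:
  assumes "1 \<le> n" "u permutes {1..n}"
  shows "block_start n (nf_word n u) 0"
  using block_start_suffix[OF nf_index(1)[OF assms], of 0] assms(1)
  by (simp add: nf_word_def word_of_index_def)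

lemma word_perm_rev_nf_word:
  assumes "1 \<le> n" "u permutes {1..n}"
  shows "word_perm (rev (nf_word n u)) = inv u"
  using nf_index(2)[OF assms] by (simp flip: inv_word_perm)

lemma leads_divdiff_perm:
  assumes "1 \<le> n" "u permutes {1..n}"
  shows "leads n (lex_below 0) (divdiff_perm n u (schubert_top n)) (code n (inv u))"
proof -
  have "leads n (lex_below (Suc 0)) (divdiff_perm n u (schubert_top n)) (code n (inv u))"
    using block_start_nf_word[OF assms]
    by (simp add: block_start_def Let_def word_perm_rev_nf_word[OF assms] divdiff_perm_def)
  then show ?thesis
    by (rule leads_mono) (auto intro: lex_below_mono)
qed

text \<open>The degree of a code counts non-inversions, and that of the identity counts all pairs.
  So the length of the normal form is the number of inversions.\<close>

lemma length_nf_word: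
  assumes "1 \<le> n" "u permutes {1..n}"
  shows "length (nf_word n u) + deg_upto n (code n (inv u)) = deg_upto n (code n id)"
  using block_start_nf_word[OF assms]
  by (simp add: block_start_def Let_def word_perm_rev_nf_word[OF assms])

text \<open>Each letter changes the number of non-inversions by exactly one, so a word is at least
  as long as the number of inversions.\<close>

lemma deg_upto_code_word:
  assumes "set w \<subseteq> {1..n - 1}"
  shows "deg_upto n (code n id) \<le> length w + deg_upto n (code n (word_perm (rev w)))"
  using assms
proof (induction w)
  case (Cons t w)
  define v where "v = word_perm (rev w)"
  define v' where "v' = v \<circ> transpose t (Suc t)"
  have t: "1 \<le> t" "t < n" using Cons.prems by auto
  have "v = v' \<circ> transpose t (Suc t)" by (simp add: v'_def comp_assoc)
  moreover have "v t \<noteq> v (Suc t)"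
    using bij_is_inj[OF bij_word_perm, of "rev w"] by (auto simp: v_def inj_eq)
  moreover have "v' t = v (Suc t)" "v' (Suc t) = v t" by (simp_all add: v'_def)
  ultimately have "deg_upto n (code n v) \<le> Suc (deg_upto n (code n v'))"
    using deg_upto_code_transpose[OF t, of v] deg_upto_code_transpose[OF t, of v'] v'_def
    by (cases "v t < v (Suc t)") auto
  moreover have "word_perm (rev (t # w)) = v'" by (simp add: v_def v'_def word_perm_append)
  ultimately show ?case using Cons by (simp add: v_def)
qed simp

text \<open>At an ascent of \<open>inv u\<close> the word attains the lower bound of
  \<open>deg_upto_code_word\<close>; at a descent the normal form of \<open>s_t u\<close> is a
  shorter competitor.\<close>

lemma reduced_word_Cons_nf_word_iff:
  assumes n: "1 \<le> n" and u: "u permutes {1..n}" and t: "t \<in> {1..n - 1}"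
  shows "reduced_word n (t # nf_word n u) \<longleftrightarrow> inv u t < inv u (Suc t)"
proof -
  define u' where "u' = transpose t (Suc t) \<circ> u"
  have u': "u' permutes {1..n}"
    unfolding u'_def using u t by (intro permutes_compose permutes_swap_id) auto
  have tn: "1 \<le> t" "t < n" using t by auto
  have perm: "word_perm (t # nf_word n u) = u'"
    using nf_index(2)[OF n u] by (simp add: u'_def)
  have inv: "inv u' = inv u \<circ> transpose t (Suc t)"
    unfolding u'_def using permutes_bij[OF u] by (simp add: o_inv_distrib)
  have len: "length (nf_word n u) + deg_upto n (code n (inv u)) = deg_upto n (code n id)"
    "length (nf_word n u') + deg_upto n (code n (inv u')) = deg_upto n (code n id)"
    using length_nf_word[OF n] u u' by auto
  show ?thesis
  proof
    assume lt: "inv u t < inv u (Suc t)"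
    show "reduced_word n (t # nf_word n u)"
      unfolding reduced_word_def perm
    proof (intro allI impI)
      fix w assume w: "set w \<subseteq> {1..n - 1} \<and> word_perm w = u'"
      then have "deg_upto n (code n id) \<le> length w + deg_upto n (code n (inv u'))"
        using deg_upto_code_word[of w n] by (simp flip: inv_word_perm)
      then show "length (t # nf_word n u) \<le> length w"
        using len(1) deg_upto_code_transpose[OF tn lt] by (simp add: inv)
    qed
  next
    assume red: "reduced_word n (t # nf_word n u)"
    have "set (nf_word n u') \<subseteq> {1..n - 1}"
      unfolding nf_word_def by (intro set_word_of_index nf_index n u')
    then have le: "length (t # nf_word n u) \<le> length (nf_word n u')"
      using red nf_index(2)[OF n u'] unfolding reduced_word_def perm by blast
    show "inv u t < inv u (Suc t)"
    proof (rule ccontr)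
      assume "\<not> inv u t < inv u (Suc t)"
      moreover have "inv u t \<noteq> inv u (Suc t)"
        using permutes_inj[OF permutes_inv[OF u]] by (auto simp: inj_eq)
      ultimately have "inv u' t < inv u' (Suc t)" by (simp add: inv)
      moreover have "inv u' \<circ> transpose t (Suc t) = inv u" by (simp add: inv fun_eq_iff)
      ultimately have "deg_upto n (code n (inv u')) = Suc (deg_upto n (code n (inv u)))"
        using deg_upto_code_transpose[OF tn, of "inv u'"] by simp
      with le len show False by simp
    qed
  qed
qed

section \<open>The monomials of the normal form\<close>

text \<open>The cycle puts the value \<open>i\<close> at the new position \<open>n + 1\<close> and
  keeps the relative order of the old values, so the only new pairs are those of \<open>k\<close>
  with \<open>n + 1\<close>.\<close>

lemma code_nth_append_desc_word:
  assumes i: "1 \<le> i" "i \<le> Suc n" and p: "p permutes {1..n}"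
  shows "code_nth (Suc n) (word_perm [i..<Suc n] \<circ> p) k =
    code_nth n p k + (if k \<in> {1..n} \<and> p k < i then 1 else 0)"
proof (cases "k \<in> {1..n}")
  case True
  let ?d = "word_perm [i..<Suc n]"
  have d: "?d x = (if x < i then x else Suc x)" if "x \<le> n" for x
    using that i by (simp add: word_perm_upt del: upt_Suc)
  have dn: "?d (Suc n) = i" using i by (simp add: word_perm_upt del: upt_Suc)
  have pn: "p (Suc n) = Suc n" using permutes_not_in[OF p] by simp
  have le: "p j \<le> n" if "j \<in> {1..n}" for j using permutes_in_image[OF p] that by (metis atLeastAtMost_iff)
  have "{j \<in> {k<..Suc n}. (?d \<circ> p) k < (?d \<circ> p) j} =
      {j \<in> {k<..n}. p k < p j} \<union> (if p k < i then {Suc n} else {})"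
  proof (intro set_eqI)
    fix j
    consider "j = Suc n" | "k < j" "j \<le> n" | "j \<notin> {k<..Suc n}" by fastforce
    then show "j \<in> {j \<in> {k<..Suc n}. (?d \<circ> p) k < (?d \<circ> p) j} \<longleftrightarrow>
        j \<in> {j \<in> {k<..n}. p k < p j} \<union> (if p k < i then {Suc n} else {})"
    proof cases
      case 1
      then show ?thesis using True pn dn d[of "p k"] le[OF True] by (auto simp del: upt_Suc)
    next
      case 2
      then have "p j \<le> n" using True le[of j] by simp
      then show ?thesis using 2 d[of "p k"] d[of "p j"] le[OF True] by (auto simp del: upt_Suc)
    next
      case 3
      then show ?thesis using True by (auto simp del: upt_Suc)
    qed
  qed
  then show ?thesis using True by (simp add: code_nth_def del: upt_Suc)
next
  case False
  then show ?thesis by (cases "k = 0") (simp_all add: code_nth_def del: upt_Suc)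
qed

lemma word_perm_word_of_index_permutes:
  assumes i: "i \<in> index_seqs n" and "m \<le> n"
  shows "word_perm (word_of_index m i) permutes {1..m}"
proof -
  have "word_of_index m i = word_of_index m (restrict i {1..m - 1})"
    by (rule word_of_index_cong) simp
  moreover have "restrict i {1..m - 1} \<in> index_seqs m"
    using assms by (auto simp: index_seqs_def PiE_iff)
  ultimately show ?thesis by (metis set_word_of_index word_perm_permutes)
qed

text \<open>Block \<open>r\<close> adds 1 at the positions whose value under the inverse of the
  earlier blocks is less than \<open>i r\<close>, that is, on the image of
  \<open>{1..i r - 1}\<close> under these blocks.\<close>

lemma code_nth_word_of_index:
  assumes i: "i \<in> index_seqs n" and "1 \<le> m" "m \<le> n"
  shows "code_nth m (word_perm (rev (word_of_index m i))) k =
    (\<Sum>r = 1..m - 1. if k \<in> word_perm (word_of_index r i) ` {1..i r - 1} then 1 else 0)"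
  using assms(2,3)
proof (induction m rule: nat_induct_at_least)
  case base
  then show ?case by (cases "k = 0") (auto simp: code_nth_def)
next
  case (Suc m)
  let ?w = "word_of_index m i"
  have im: "1 \<le> i m" "i m \<le> Suc m" using i Suc by (auto simp: index_seqs_def PiE_iff)
  have p: "word_perm (rev ?w) permutes {1..m}" "word_perm ?w permutes {1..m}"
    using word_perm_word_of_index_permutes[OF i, of m] Suc.prems
      permutes_inv[of "word_perm ?w" "{1..m}"] by (simp_all add: inv_word_perm)
  have "k \<in> {1..m} \<and> word_perm (rev ?w) k < i m \<longleftrightarrow> k \<in> word_perm ?w ` {1..i m - 1}"
  proof
    assume k: "k \<in> {1..m} \<and> word_perm (rev ?w) k < i m"
    then have "word_perm (rev ?w) k \<in> {1..m}" using permutes_in_image[OF p(1)] by blast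
    with k show "k \<in> word_perm ?w ` {1..i m - 1}"
      by (intro image_eqI[of _ _ "word_perm (rev ?w) k"]) auto
  next
    assume "k \<in> word_perm ?w ` {1..i m - 1}"
    then obtain x where x: "k = word_perm ?w x" "x \<in> {1..i m - 1}" by auto
    then have "x \<in> {1..m}" using im by auto
    then have "k \<in> {1..m}" using permutes_in_image[OF p(2)] x(1) by blast
    moreover have "x < i m" using x(2) by auto
    ultimately show "k \<in> {1..m} \<and> word_perm (rev ?w) k < i m" using x(1) by simp
  qed
  moreover have "word_perm (rev (word_of_index (Suc m) i)) = word_perm [i m..<Suc m] \<circ> word_perm (rev ?w)"
    using Suc.hyps by (simp add: word_of_index_Suc word_perm_append del: upt_Suc)
  ultimately have "code_nth (Suc m) (word_perm (rev (word_of_index (Suc m) i))) k =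
      code_nth m (word_perm (rev ?w)) k + (if k \<in> word_perm ?w ` {1..i m - 1} then 1 else 0)"
    using code_nth_append_desc_word[OF im p(1), of k] by simp
  moreover have "{1..Suc m - 1} = insert m {1..m - 1}" using Suc.hyps by auto
  ultimately show ?case using Suc by (simp del: image_eqI)
qed

text \<open>The cycle throws \<open>i\<close> up to \<open>j + 1\<close> and lowers
  \<open>i + 1, ..., j + 1\<close> by one. This is where the condition on intervals in
  \<open>M_below\<close> comes from.\<close>

lemma word_perm_desc_word_image:
  assumes "i \<le> j" "1 \<le> i"
  shows "i \<le> z \<Longrightarrow> z \<le> j \<Longrightarrow> word_perm (desc_word j i) ` {1..z} = insert (Suc j) {1..z - 1}"
    and "z < i \<or> j < z \<Longrightarrow> word_perm (desc_word j i) ` {1..z} = {1..z}"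
proof -
  let ?d = "word_perm (desc_word j i)"
  have d: "?d x = (if x < i \<or> Suc j < x then x else if x = i then Suc j else x - 1)" for x
    using assms by (intro word_perm_desc_word) simp
  have e: "?d (word_perm (rev (desc_word j i)) y) = y" for y
    by (rule word_perm_rev_inverse(2))
  have d': "word_perm (rev (desc_word j i)) y =
      (if y < i \<or> Suc j < y then y else if y = Suc j then i else Suc y)" for y
    using assms word_perm_upt[of i j y] by (simp del: upt_Suc)
  have mem: "y \<in> ?d ` {1..z} \<longleftrightarrow> word_perm (rev (desc_word j i)) y \<in> {1..z}" for y
    using e by (metis (no_types, lifting) image_iff word_perm_rev_inverse(1))
  show "?d ` {1..z} = insert (Suc j) {1..z - 1}" if "i \<le> z" "z \<le> j"
    unfolding set_eq_iff mem d' using that assms by auto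
  show "?d ` {1..z} = {1..z}" if "z < i \<or> j < z"
    unfolding set_eq_iff mem d' using that assms by auto
qed

text \<open>The last block acts first, so blocks \<open>b - 1, ..., a\<close> can be peeled off
  while none of them moves the interval.\<close>

lemma word_of_index_image_fixed:
  assumes i: "\<And>j. j \<in> {1..<b} \<Longrightarrow> 1 \<le> i j \<and> i j \<le> Suc j" and ab: "1 \<le> a" "a \<le> b"
    and fixed: "\<And>j. j \<in> {a..<b} \<Longrightarrow> z \<notin> {i j..j}"
  shows "word_perm (word_of_index b i) ` {1..z} = word_perm (word_of_index a i) ` {1..z}"
  using ab(2) i fixed
proof (induction b rule: nat_induct_at_least)
  case (Suc b)
  have "word_perm (desc_word b (i b)) ` {1..z} = {1..z}"
  proof (cases "i b \<le> b")
    case True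
    then show ?thesis
      using Suc.prems Suc.hyps ab by (intro word_perm_desc_word_image(2)) (auto simp: not_le)
  next
    case False
    then show ?thesis by simp
  qed
  moreover have "word_perm (word_of_index (Suc b) i) = word_perm (word_of_index b i) \<circ> word_perm (desc_word b (i b))"
    using Suc.hyps ab by (simp add: word_of_index_Suc word_perm_append)
  ultimately have "word_perm (word_of_index (Suc b) i) ` {1..z} = word_perm (word_of_index b i) ` {1..z}"
    by (simp only: image_comp[symmetric])
  also have "\<dots> = word_perm (word_of_index a i) ` {1..z}"
    using Suc.prems by (intro Suc.IH) auto
  finally show ?case .
qed simp

lemma M_below_eq: "M_below i r (Suc l) q = {j. 1 \<le> j \<and> j < q \<and> l < i r \<and> i r - Suc l \<in> {i j..j}}"
  if "\<And>j. j \<in> {1..<q} \<Longrightarrow> 1 \<le> i j"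
  using that by (fastforce simp: M_below_def)

text \<open>Follow \<open>{1..i r - 1}\<close> through the blocks \<open>r - 1, ..., 1\<close>. The
  next block that changes the remaining interval is the next \<open>q\<close> of the sequence: it
  expels the element \<open>q + 1\<close> and shortens the interval by one. Earlier blocks fix
  \<open>q + 1\<close>, so the expelled elements are final.\<close>

lemma X_monom_eq:
  assumes i: "i \<in> index_seqs n" and r: "1 \<le> r" "r < n"
  shows "X_monom i r = (\<Sum>k \<in> word_perm (word_of_index r i) ` {1..i r - 1}. var_monom k)"
proof -
  let ?P = "\<lambda>q. word_perm (word_of_index q i)"
  let ?q = "q_seq i r"
  define m where "m = m_val i r"
  have ij: "1 \<le> i j \<and> i j \<le> Suc j" if "j \<in> {1..<n}" for j
    using i that by (auto simp: index_seqs_def PiE_iff)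
  have finite_M: "finite (M_below i r l q)" for l q
    by (rule finite_subset[of _ "{..<q}"]) (auto simp: M_below_def)
  have q_in: "?q (Suc l) \<in> M_below i r (Suc l) (?q l)" if "M_set i r (Suc l) \<noteq> {}" for l
    using that finite_M by (simp add: M_set_def)
  \<comment> \<open>Without an empty stage \<open>q_seq\<close> would decrease strictly forever.
    This makes the \<open>LEAST\<close> in \<open>m_val\<close> meaningful.\<close>
  have ex: "\<exists>l. M_set i r (Suc l) = {}"
  proof (rule ccontr)
    assume "\<not> ?thesis"
    then have "?q (Suc l) < ?q l" for l using q_in[of l] by (auto simp: M_below_def)
    then have "?q l + l \<le> ?q 0" for l
      by (induction l) (simp_all, metis Suc_leI add_Suc_right le_trans add_le_mono1 add_Suc)
    from this[of "Suc r"] show False by simp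
  qed
  have M_m: "M_set i r (Suc m) = {}" unfolding m_def m_val_def by (rule LeastI_ex[OF ex])
  have M_l: "M_set i r (Suc l) \<noteq> {}" if "l < m" for l
    using that not_less_Least unfolding m_def m_val_def by blast
  \<comment> \<open>The bound \<open>l < i r\<close> is carried along to keep the truncated
    subtraction exact.\<close>
  have trace: "1 \<le> ?q l \<and> ?q l \<le> r \<and> l < i r \<and> (\<Sum>k \<in> ?P r ` {1..i r - 1}. var_monom k) =
      (\<Sum>k \<in> ?P (?q l) ` {1..i r - Suc l}. var_monom k) + (\<Sum>k = 1..l. var_monom (1 + ?q k))"
    if "l \<le> m" for l
    using that
  proof (induction l)
    case 0
    then show ?case using r ij[of r] by simp
  next
    case (Suc l)
    then have IH: "1 \<le> ?q l" "?q l \<le> r" "l < i r"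
      "(\<Sum>k \<in> ?P r ` {1..i r - 1}. var_monom k) =
      (\<Sum>k \<in> ?P (?q l) ` {1..i r - Suc l}. var_monom k) + (\<Sum>k = 1..l. var_monom (1 + ?q k))"
      by auto
    define z where "z = i r - Suc l"
    define q where "q = ?q (Suc l)"
    have ijq: "1 \<le> i j" if "j \<in> {1..<?q l}" for j using ij[of j] that IH r by auto
    have M: "M_below i r (Suc l) (?q l) = {j. 1 \<le> j \<and> j < ?q l \<and> z \<in> {i j..j}}"
      using M_below_eq[OF ijq] IH(3) by (simp add: z_def)
    have q: "1 \<le> q" "q < ?q l" "i q \<le> z" "z \<le> q"
      using q_in[of l] M_l[of l] Suc.prems unfolding M by (auto simp: q_def)
    have iq: "1 \<le> i q" using ijq[of q] q by simp
    have p: "?P q permutes {1..q}"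
      using q IH(2) r by (intro word_perm_word_of_index_permutes[OF i]) simp
    \<comment> \<open>By maximality of \<open>q\<close>, the blocks between \<open>q\<close> and its
      predecessor in the sequence fix the interval.\<close>
    have "z \<notin> {i j..j}" if "j \<in> {Suc q..<?q l}" for j
    proof
      assume "z \<in> {i j..j}"
      then have "j \<in> M_below i r (Suc l) (?q l)" using that unfolding M by auto
      then have "j \<le> q" using finite_M by (simp add: q_def)
      with that show False by simp
    qed
    then have "?P (?q l) ` {1..z} = ?P (Suc q) ` {1..z}"
      using ij q IH(1,2) r by (intro word_of_index_image_fixed) auto
    also have "\<dots> = ?P q ` word_perm (desc_word q (i q)) ` {1..z}"
      using q by (simp add: word_of_index_Suc word_perm_append image_comp)
    also have "\<dots> = ?P q ` insert (Suc q) {1..z - 1}"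
      using word_perm_desc_word_image(1)[of "i q" q z] q iq by simp
    also have "\<dots> = insert (Suc q) (?P q ` {1..z - 1})"
      using permutes_not_in[OF p, of "Suc q"] by simp
    finally have "(\<Sum>k \<in> ?P (?q l) ` {1..z}. var_monom k) =
        (\<Sum>k \<in> insert (Suc q) (?P q ` {1..z - 1}). var_monom k)" by simp
    moreover have "Suc q \<notin> ?P q ` {1..z - 1}"
    proof -
      have "?P q x \<in> {1..q}" if "x \<in> {1..z - 1}" for x
        using permutes_in_image[OF p, of x] that q by fastforce
      then show ?thesis by fastforce
    qed
    ultimately have "(\<Sum>k \<in> ?P (?q l) ` {1..z}. var_monom k) =
        var_monom (Suc q) + (\<Sum>k \<in> ?P q ` {1..z - 1}. var_monom k)" by simp
    moreover have "(\<Sum>k = 1..Suc l. var_monom (1 + ?q k)) =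
        (\<Sum>k = 1..l. var_monom (1 + ?q k)) + var_monom (Suc q)"
      by (simp add: q_def)
    moreover have "z - 1 = i r - Suc (Suc l)" "Suc l < i r"
      using q iq by (simp_all add: z_def)
    ultimately show ?case
      using IH q by (simp add: q_def[symmetric] z_def[symmetric] add_ac del: q_seq.simps(2))
  qed
  \<comment> \<open>The next candidate set is empty, so no remaining block moves the interval; its
    variables form the first factor of \<open>X_monom\<close>.\<close>
  have "?P (?q m) ` {1..i r - Suc m} = ?P 1 ` {1..i r - Suc m}"
  proof (rule word_of_index_image_fixed)
    have ijq: "1 \<le> i j" if "j \<in> {1..<?q m}" for j using ij[of j] that trace[of m] r by auto
    have "i r - Suc m \<notin> {i j..j}" if "j \<in> {1..<?q m}" for j
      using M_m M_below_eq[OF ijq] trace[of m] that by (fastforce simp: M_set_def)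
    then show "\<And>j. j \<in> {1..<?q m} \<Longrightarrow> i r - Suc m \<notin> {i j..j}" .
  qed (use trace[of m] r ij in auto)
  then have "?P (?q m) ` {1..i r - Suc m} = {1..i r - Suc m}"
    by (simp add: word_of_index_def)
  then have "(\<Sum>k \<in> ?P r ` {1..i r - 1}. var_monom k) =
      (\<Sum>k = 1..i r - Suc m. var_monom k) + (\<Sum>k = 1..m. var_monom (1 + ?q k))"
    using trace[of m] by simp
  then show ?thesis by (simp add: X_monom_def m_def)
qed

lemma sum_X_monom_eq_code:
  assumes i: "i \<in> index_seqs n" and "1 \<le> n"
  shows "(\<Sum>j = 1..n - 1. X_monom i j) = code n (word_perm (rev (word_of_index n i)))"
proof (rule poly_mapping_eqI)
  fix k
  have "Poly_Mapping.lookup (\<Sum>j = 1..n - 1. X_monom i j) k =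
      (\<Sum>j = 1..n - 1. Poly_Mapping.lookup (X_monom i j) k)" by (rule lookup_sum)
  also have "\<dots> = (\<Sum>j = 1..n - 1. if k \<in> word_perm (word_of_index j i) ` {1..i j - 1} then 1 else 0)"
  proof (rule sum.cong)
    fix j assume "j \<in> {1..n - 1}"
    then have "1 \<le> j" "j < n" by auto
    let ?A = "word_perm (word_of_index j i) ` {1..i j - 1}"
    have "Poly_Mapping.lookup (X_monom i j) k = (\<Sum>a\<in>?A. if k = a then 1 else 0)"
      unfolding X_monom_eq[OF i \<open>1 \<le> j\<close> \<open>j < n\<close>] lookup_sum var_monom_def
      by (intro sum.cong) (auto simp: lookup_single when_def)
    also have "\<dots> = (if k \<in> ?A then 1 else 0)"
      by (subst sum.delta') simp_all
    finally show "Poly_Mapping.lookup (X_monom i j) k = (if k \<in> ?A then 1 else 0)" .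
  qed simp
  also have "\<dots> = Poly_Mapping.lookup (code n (word_perm (rev (word_of_index n i)))) k"
    using code_nth_word_of_index[OF i assms(2) order.refl, of k] by simp
  finally show "Poly_Mapping.lookup (\<Sum>j = 1..n - 1. X_monom i j) k =
    Poly_Mapping.lookup (code n (word_perm (rev (word_of_index n i)))) k" .
qed

section \<open>Braid relations and multiplication by a generator\<close>

text \<open>Collects the relations common to transpositions and divided differences, whose squares
  differ. A rewriting of words inside this locale yields an identity of permutations and one of
  operators at once.\<close>

locale braid_action =
  fixes g :: "nat \<Rightarrow> 'x \<Rightarrow> 'x"
  assumes commute: "Suc a < b \<Longrightarrow> g a (g b x) = g b (g a x)"
    and braid: "g a (g (Suc a) (g a x)) = g (Suc a) (g a (g (Suc a) x))"
begin

definition act :: "nat list \<Rightarrow> 'x \<Rightarrow> 'x"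
  where "act w = foldr g w"

lemma act_Nil [simp]: "act [] x = x"
  and act_Cons [simp]: "act (a # w) x = g a (act w x)"
  and act_append [simp]: "act (v @ w) x = act v (act w x)"
  by (simp_all add: act_def)

lemma act_commute: "(\<And>a. a \<in> set w \<Longrightarrow> Suc a < t \<or> Suc t < a) \<Longrightarrow> g t (act w x) = act w (g t x)"
proof (induction w)
  case (Cons a w)
  then have "g t (g a (act w x)) = g a (g t (act w x))"
    using commute[of a t] commute[of t a] by (metis list.set_intros(1))
  with Cons show ?case by simp
qed simp

text \<open>The letter \<open>y\<close> commutes past \<open>a, ..., y - 2\<close>, becomes
  \<open>y - 1\<close> in a braid move with \<open>y\<close> and \<open>y - 1\<close>, and then
  commutes past \<open>y + 1, ..., t\<close>.\<close>

lemma act_desc_word_letter: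
  assumes "a < y" "y \<le> t"
  shows "act (desc_word t a) (g y x) = g (y - 1) (act (desc_word t a) x)"
proof -
  obtain z where y: "y = Suc z" using assms by (cases y) auto
  have "[a..<Suc t] = [a..<z] @ [z, Suc z] @ [Suc (Suc z)..<Suc t]"
    using assms y upt_add_eq_append[of a z "Suc t - z"] by (simp add: upt_conv_Cons del: upt_Suc)
  then have split: "desc_word t a = rev [Suc (Suc z)..<Suc t] @ [Suc z, z] @ rev [a..<z]"
    by (simp add: desc_word_def del: upt_Suc)
  have "act (desc_word t a) (g y x) = act (rev [Suc (Suc z)..<Suc t]) (g (Suc z) (g z (g (Suc z) (act (rev [a..<z]) x))))"
    unfolding split using act_commute[of "rev [a..<z]" y x] y by (simp del: upt_Suc)
  also have "\<dots> = act (rev [Suc (Suc z)..<Suc t]) (g z (g (Suc z) (g z (act (rev [a..<z]) x))))"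
    by (simp only: braid)
  also have "\<dots> = g z (act (rev [Suc (Suc z)..<Suc t]) (g (Suc z) (g z (act (rev [a..<z]) x))))"
    by (rule act_commute[symmetric]) auto
  finally show ?thesis by (simp add: split y del: upt_Suc)
qed

lemma act_desc_word_word:
  "set w \<subseteq> {a<..t} \<Longrightarrow> act (desc_word t a) (act w x) = act (map (\<lambda>y. y - 1) w) (act (desc_word t a) x)"
  by (induction w) (simp_all add: act_desc_word_letter)

lemma act_desc_word_desc_word:
  assumes "a < b" "b \<le> Suc t" "1 \<le> t"
  shows "act (desc_word t a) (act (desc_word t b) x) =
    act (desc_word (t - 1) (b - 1)) (act (desc_word t a) x)"
proof -
  have "map (\<lambda>y. y - 1) (desc_word t b) = desc_word (t - 1) (b - 1)"
    using assms map_decr_upt[of "b - 1" t] by (simp add: desc_word_def rev_map[symmetric] del: upt_Suc)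
  moreover have "set (desc_word t b) \<subseteq> {a<..t}"
    using assms by (auto simp: desc_word_def)
  ultimately show ?thesis using act_desc_word_word by metis
qed

end

interpretation perm: braid_action "\<lambda>a p. transpose a (Suc a) \<circ> p"
  by unfold_locales (auto simp: fun_eq_iff transpose_def)

interpretation dd: braid_action divdiff
  by unfold_locales (fact divdiff_commute divdiff_braid)+

lemma perm_act: "perm.act w p = word_perm w \<circ> p"
  by (induction w) (simp_all only: perm.act_Nil perm.act_Cons word_perm_Nil word_perm_Cons comp_assoc id_comp)

lemma dd_act: "dd.act w f = divdiff_word w f"
  by (induction w) simp_all

section \<open>The normal form of \<open>s_t u\<close>\<close>

lemma word_of_index_split:
  assumes t: "t \<in> {1..n - 1}"
  shows "word_of_index n i = word_of_index (t - 1) i @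
    desc_word (t - 1) (if t = 1 then 1 else i (t - 1)) @ desc_word t (i t) @
    concat (map (\<lambda>j. desc_word j (i j)) [Suc t..<n])"
proof -
  have "[1..<n] = [1..<t] @ t # [Suc t..<n]"
  proof -
    have "1 \<le> t" "t < n" using t by auto
    then show ?thesis using upt_add_eq_append[of 1 t "n - t"] by (simp add: upt_conv_Cons del: upt_Suc)
  qed
  then have "word_of_index n i = word_of_index t i @ desc_word t (i t) @
      concat (map (\<lambda>j. desc_word j (i j)) [Suc t..<n])"
    by (simp add: word_of_index_def)
  moreover have "word_of_index t i = word_of_index (t - 1) i @ desc_word (t - 1) (if t = 1 then 1 else i (t - 1))"
  proof (cases "t = 1")
    case False
    then have "1 \<le> t - 1" using t by auto
    then show ?thesis using False word_of_index_Suc[of "t - 1" i] by simp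
  qed (simp add: word_of_index_def)
  ultimately show ?thesis by simp
qed

lemma set_word_of_index_less: "a \<in> set (word_of_index n i) \<Longrightarrow> a < n"
  by (auto simp: word_of_index_def desc_word_def simp del: upt_Suc)

lemma nf_index_eqI:
  assumes "1 \<le> n" "i \<in> index_seqs n" "word_perm (word_of_index n i) = u"
  shows "nf_index n u = i"
proof -
  have u: "u permutes {1..n}"
    using word_perm_permutes[OF set_word_of_index[OF assms(2)]] assms(3) by simp
  show ?thesis unfolding nf_index_def using nf_index_ex1[OF assms(1) u] assms(2,3) by (intro the1_equality) auto
qed

text \<open>The letter \<open>s_t\<close> commutes with the blocks before \<open>t - 1\<close> and
  extends \<open>s_(t-1,a)\<close> to \<open>s_(t,a)\<close>. The ascent forces
  \<open>a < b\<close>, and then \<open>s_(t,a) s_(t,b) = s_(t-1,b-1) s_(t,a)\<close> restores a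
  normal form by braid relations alone.\<close>

lemma divdiff_word_Cons_nf_word:
  assumes n: "1 \<le> n" and u: "u permutes {1..n}" and t: "t \<in> {1..n - 1}"
    and lt: "inv u t < inv u (Suc t)"
  shows "divdiff_word (t # nf_word n u) f = divdiff_perm n (transpose t (Suc t) \<circ> u) f"
proof -
  define i where "i = nf_index n u"
  \<comment> \<open>For \<open>t = 1\<close> there is no block \<open>t - 1\<close>; the value 1
    makes \<open>desc_word 0 a\<close> empty.\<close>
  define a where "a = (if t = 1 then 1 else i (t - 1))"
  define b where "b = i t"
  define suf where "suf = concat (map (\<lambda>j. desc_word j (i j)) [Suc t..<n])"
  define pre where "pre = word_of_index (t - 1) i"
  have i: "i \<in> index_seqs n" unfolding i_def by (rule nf_index[OF n u])
  then have ij: "1 \<le> i j \<and> i j \<le> Suc j" if "j \<in> {1..n - 1}" for j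
    using that by (auto simp: index_seqs_def PiE_iff)
  have "1 \<le> i (t - 1) \<and> i (t - 1) \<le> t" if "t \<noteq> 1"
  proof -
    have "t - 1 \<in> {1..n - 1}" using t that by auto
    from ij[OF this] show ?thesis using t by simp
  qed
  then have a: "1 \<le> a" "a \<le> t" using t by (auto simp: a_def)
  have b: "1 \<le> b" "b \<le> Suc t" using ij[of t] t by (auto simp: b_def)
  have word: "nf_word n u = pre @ desc_word (t - 1) a @ desc_word t b @ suf"
    unfolding nf_word_def i_def[symmetric] pre_def a_def b_def suf_def by (rule word_of_index_split[OF t])
  have pre: "Suc x < t" if "x \<in> set pre" for x
    using set_word_of_index_less[of x "t - 1" i] that by (simp add: pre_def)
  have t_desc: "t # desc_word (t - 1) a = desc_word t a"
    using a t desc_word_Suc[of a "t - 1"] by simp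
  \<comment> \<open>Otherwise \<open>inv u\<close> takes the values \<open>v (a + 1)\<close> and
    \<open>v b\<close> at \<open>t\<close> and \<open>t + 1\<close>, where \<open>b \<le> a\<close>
    and \<open>v\<close> is increasing, against the assumed ascent.\<close>
  have "a < b"
  proof (rule ccontr)
    assume "\<not> a < b"
    define v where "v = word_perm (rev suf)"
    have mono: "strict_mono_on {1..Suc t} v"
      using block_start_suffix[OF i, of t] t
      by (auto simp: block_start_def Let_def v_def suf_def)
    have fix_pre: "word_perm (rev pre) x = x" if "t \<le> x" for x
    proof -
      have "set (rev pre) \<subseteq> {..<t - 1}" using pre by (auto simp: less_diff_conv)
      then show ?thesis using that
      proof (induction "rev pre" arbitrary: pre)
        case (Cons y w)
        show ?case
          using Cons.hyps(1)[of "rev w"] Cons.hyps(2)[symmetric] Cons.prems by (auto simp: transpose_def)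
      qed simp
    qed
    have inv_u: "inv u = v \<circ> word_perm [b..<Suc t] \<circ> word_perm [a..<t] \<circ> word_perm (rev pre)"
      using word_perm_rev_nf_word[OF n u] a unfolding word
      by (simp add: word_perm_append v_def comp_assoc del: upt_Suc)
    have "word_perm [a..<t] t = a" "word_perm [a..<t] (Suc t) = Suc t"
      using word_perm_upt[of a "t - 1"] a by simp_all
    then have "inv u t = v (Suc a)" "inv u (Suc t) = v b"
      using a b \<open>\<not> a < b\<close> t
      by (auto simp: inv_u fix_pre word_perm_upt simp del: upt_Suc)
    moreover have "v b < v (Suc a)"
      using mono a b \<open>\<not> a < b\<close> by (intro strict_mono_onD[OF mono]) auto
    ultimately show False using lt by simp
  qed
  \<comment> \<open>For \<open>t = 1\<close> index 0 stays untouched to keep \<open>i'\<close>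
    extensional; in that case \<open>b = 2\<close>, so the block \<open>s_(0,b-1)\<close> is empty
    as well.\<close>
  define i' where "i' = (if t = 1 then i(t := a) else i(t - 1 := b - 1, t := a))"
  have i': "i' \<in> index_seqs n"
    using i a b t \<open>a < b\<close> by (auto simp: i'_def index_seqs_def PiE_iff extensional_def)
  have "t = 1 \<Longrightarrow> b = 2" using \<open>a < b\<close> a b by simp
  have word': "word_of_index n i' = pre @ desc_word (t - 1) (b - 1) @ desc_word t a @ suf"
  proof -
    have "word_of_index (t - 1) i' = pre"
      unfolding pre_def by (rule word_of_index_cong) (auto simp: i'_def)
    moreover have "map (\<lambda>j. desc_word j (i' j)) [Suc t..<n] = map (\<lambda>j. desc_word j (i j)) [Suc t..<n]"
      by (rule map_cong) (auto simp: i'_def)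
    moreover have "(if t = 1 then 1 else i' (t - 1)) = b - 1"
      using t \<open>t = 1 \<Longrightarrow> b = 2\<close> by (auto simp: i'_def)
    moreover have "i' t = a" by (simp add: i'_def)
    ultimately show ?thesis using word_of_index_split[OF t, of i'] by (simp only: suf_def)
  qed
  \<comment> \<open>Used twice: on permutations it identifies the normal form of
    \<open>s_t u\<close>, on divided differences it carries over the operator.\<close>
  have rewrite: "braid_action.act g (t # nf_word n u) x = braid_action.act g (word_of_index n i') x"
    if "braid_action g" for g :: "nat \<Rightarrow> 'x \<Rightarrow> 'x" and x
  proof -
    interpret braid_action g by fact
    let ?y = "act (desc_word t b) (act suf x)"
    have "act (t # nf_word n u) x = act pre (g t (act (desc_word (t - 1) a) ?y))"
      unfolding word using pre act_commute[of pre t] by simp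
    also have "g t (act (desc_word (t - 1) a) ?y) = act (desc_word t a) ?y"
      by (simp flip: t_desc)
    also have "\<dots> = act (desc_word (t - 1) (b - 1)) (act (desc_word t a) (act suf x))"
      using \<open>a < b\<close> b t by (intro act_desc_word_desc_word) auto
    finally show ?thesis by (simp add: word')
  qed
  have "word_perm (word_of_index n i') = word_perm (t # nf_word n u)"
    using rewrite[OF perm.braid_action_axioms, of id] by (simp add: perm_act)
  also have "\<dots> = transpose t (Suc t) \<circ> u" using nf_index(2)[OF n u] by simp
  finally have "nf_word n (transpose t (Suc t) \<circ> u) = word_of_index n i'"
    unfolding nf_word_def by (simp add: nf_index_eqI[OF n i'])
  then show ?thesis
    using rewrite[OF dd.braid_action_axioms, of f] by (simp add: dd_act divdiff_perm_def)
qed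

theorem theorem3:
  fixes n t :: nat and u :: "nat \<Rightarrow> nat"
  assumes "n \<ge> 2" and "u permutes {1..n}" and "t \<in> {1..n - 1}"
  shows
    "(monic n (divdiff_perm n u (schubert_top n)) \<and>
      lead_monom n (divdiff_perm n u (schubert_top n)) =
        (\<Sum>j = 1..n - 1. X_monom (nf_index n u) j) \<and>
      bij_betw (phi n) {v. v permutes {1..n}} (B_x n) \<and>
      (\<forall>v. v permutes {1..n} \<and> u \<noteq> v \<longrightarrow>
        lead_monom n (divdiff_perm n u (schubert_top n)) \<noteq>
        lead_monom n (divdiff_perm n v (schubert_top n))))
    \<and>
     (let W = lead_monom n (divdiff_perm n u (schubert_top n)) in
      (reduced_word n (t # nf_word n u) \<longleftrightarrow>
        Poly_Mapping.lookup W t > Poly_Mapping.lookup W (t + 1)) \<and>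
      (Poly_Mapping.lookup W t > Poly_Mapping.lookup W (t + 1) \<longrightarrow>
        lead_monom n (divdiff_word (t # nf_word n u) (schubert_top n)) =
        lead_monom n (divdiff t (mpoly_of_monom W))))"
proof -
  have n: "1 \<le> n" using assms(1) by simp
  have t: "1 \<le> t" "t < n" using assms(3) by auto
  note u = assms(2)
  have lead: "lead_monom n (divdiff_perm n v (schubert_top n)) = code n (inv v)"
    "monic n (divdiff_perm n v (schubert_top n))" if "v permutes {1..n}" for v
    using lead_monom_eqI[OF leads_divdiff_perm[OF n that]] by simp_all
  have X: "(\<Sum>j = 1..n - 1. X_monom (nf_index n v) j) = code n (inv v)" if "v permutes {1..n}" for v
    using sum_X_monom_eq_code[OF nf_index(1)[OF n that] n] word_perm_rev_nf_word[OF n that]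
    by (simp add: nf_word_def)
  have bij: "bij_betw (phi n) {v. v permutes {1..n}} (B_x n)"
    using bij_betw_code[OF n] X by (subst bij_betw_cong[of _ _ "\<lambda>v. code n (inv v)"]) (auto simp: phi_def)
  have neq: "lead_monom n (divdiff_perm n u (schubert_top n)) \<noteq>
      lead_monom n (divdiff_perm n v (schubert_top n))" if "v permutes {1..n}" "u \<noteq> v" for v
    using bij_betw_imp_inj_on[OF bij_betw_code[OF n]] u that by (auto simp: lead inj_on_def)
  define v where "v = inv u"
  have "v t \<noteq> v (Suc t)"
    using permutes_inj[OF permutes_inv[OF u]] by (auto simp: v_def inj_eq)
  have lt_iff: "code_nth n v (Suc t) < code_nth n v t \<longleftrightarrow> v t < v (Suc t)"
  proof
    assume less: "code_nth n v (Suc t) < code_nth n v t"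
    show "v t < v (Suc t)"
    proof (rule ccontr)
      assume "\<not> v t < v (Suc t)"
      \<comment> \<open>Applied to the map with the two values interchanged,
        \<open>code_nth_transpose\<close> bounds the entry of \<open>v\<close> at \<open>t\<close>
        by that at \<open>t + 1\<close>.\<close>
      with \<open>v t \<noteq> v (Suc t)\<close> have "(v \<circ> transpose t (Suc t)) t < (v \<circ> transpose t (Suc t)) (Suc t)"
        by simp
      moreover have "v \<circ> transpose t (Suc t) \<circ> transpose t (Suc t) = v" by (simp add: fun_eq_iff)
      ultimately show False
        using code_nth_transpose(4)[OF t, of "v \<circ> transpose t (Suc t)"]
          code_nth_transpose(1,2)[OF t, of "v \<circ> transpose t (Suc t)"] less by simp
    qed
  qed (rule code_nth_transpose(4)[OF t])
  \<comment> \<open>Both sides equal \<open>code n ?v'\<close>: the left by the normal form of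
    \<open>s_t u\<close>, the right by \<open>leads_divdiff\<close> for a single monomial, which has
    no competitors.\<close>
  have "lead_monom n (divdiff_word (t # nf_word n u) (schubert_top n)) =
      lead_monom n (divdiff t (mpoly_of_monom (code n v)))" if lt: "v t < v (Suc t)"
  proof -
    let ?v' = "v \<circ> transpose t (Suc t)"
    have "(transpose t (Suc t) \<circ> u) permutes {1..n}"
      using u assms(3) by (intro permutes_compose permutes_swap_id) auto
    from lead(1)[OF this] have "lead_monom n (divdiff_word (t # nf_word n u) (schubert_top n)) = code n ?v'"
      using divdiff_word_Cons_nf_word[OF n u assms(3)] lt permutes_bij[OF u]
      by (simp add: v_def o_inv_distrib)
    moreover have "leads n (\<lambda>V W. lex_below (Suc t) V W \<or> below_at (Suc t) V W)
        (divdiff t (mpoly_of_monom (code n v))) (code n ?v')"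
      unfolding mpoly_of_monom_def using t code_nth_transpose[OF t lt]
      by (intro leads_divdiff[OF leads_single]) simp_all
    then have "leads n (lex_below 0) (divdiff t (mpoly_of_monom (code n v))) (code n ?v')"
      by (rule leads_mono) (auto intro: lex_below_mono below_at_imp_lex_below)
    ultimately show ?thesis by (simp add: lead_monom_eqI(1))
  qed
  moreover have "reduced_word n (t # nf_word n u) \<longleftrightarrow> code_nth n v (Suc t) < code_nth n v t"
    using reduced_word_Cons_nf_word_iff[OF n u assms(3)] lt_iff by (simp add: v_def)
  moreover have "lead_monom n (divdiff_perm n u (schubert_top n)) = code n v"
    "(\<Sum>j = 1..n - 1. X_monom (nf_index n u) j) = code n v"
    using lead(1)[OF u] X[OF u] by (simp_all add: v_def)
  ultimately show ?thesis
    unfolding Let_def using lead(2)[OF u] bij neq lt_iff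
    by (intro conjI allI impI) (simp_all only: lookup_code Suc_eq_plus1[symmetric], blast?)
qed

end
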